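(* A poset is a geometric semilattice if and only if it is isomorphic to the poset of flats of a semimatroid. Furthermore, each geometric semilattice is the poset of flats of a unique simple semimatroid, up to isomorphism.
   Context: $\mathbb{N}$ includes $0$; matroids and semimatroids have finite ground sets. A simplicial complex on a finite set $S$ is a family of subsets of $S$ closed under taking subsets; singletons need not belong to it. A semimatroid is a triple $(S,\mathcal{C},r_{\mathcal{C}})$ consisting of a finite set $S$, a non-empty simplicial complex $\mathcal{C}$ on $S$, and a function $r_{\mathcal{C}}:\mathcal{C}\to\mathbb{N}$ such that: (R1) if $X\in\mathcal{C}$ then $0\le r_{\mathcal{C}}(X)\le |X|$; (R2) if $X,Y\in\mathcal{C}$ and $X\subseteq Y$ then $r_{\mathcal{C}}(X)\le r_{\mathcal{C}}(Y)$; (R3) if $X,Y\in\mathcal{C}$ and $X\cup Y\in\mathcal{C}$ then $r_{\mathcal{C}}(X)+r_{\mathcal{C}}(Y)\ge r_{\mathcal{C}}(X\cup Y)+r_{\mathcal{C}}(X\cap Y)$; (CR1) if $X,Y\in\mathcal{C}$ and $r_{\mathcal{C}}(X)=r_{\mathcal{C}}(X\cap Y)$ then $X\cup Y\in\mathcal{C}$; (CR2) if $X,Y\in\mathcal{C}$ and $r_{\mathcal{C}}(X)<r_{\mathcal{C}}(Y)$ then $X\cup\{y\}\in\mathcal{C}$ for some $y\in Y-X$. For $X\in\mathcal{C}$ the closure is $\mathrm{cl}_{\mathcal{C}}(X)=\{x\in S\mid X\cup\{x\}\in\mathcal{C},\ r_{\mathcal{C}}(X\cup\{x\})=r_{\mathcal{C}}(X)\}$.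 A flat is a set $A\in\mathcal{C}$ with $\mathrm{cl}_{\mathcal{C}}(A)=A$; the poset of flats is the set of flats ordered by containment. The semimatroid is simple if $\{x\}\in\mathcal{C}$ and $r_{\mathcal{C}}(\{x\})=1$ for all $x\in S$, and $r_{\mathcal{C}}(\{x,y\})=2$ for all $\{x,y\}\in\mathcal{C}$ with $x\ne y$. Two semimatroids $(S_1,\mathcal{C}_1,r_{\mathcal{C}_1})$, $(S_2,\mathcal{C}_2,r_{\mathcal{C}_2})$ are isomorphic if there is a bijection $f:S_1\to S_2$ inducing an isomorphism of simplicial complexes $f:\mathcal{C}_1\to\mathcal{C}_2$ with $r_{\mathcal{C}_1}(c)=r_{\mathcal{C}_2}(f(c))$ for all $c\in\mathcal{C}_1$. A meet semilattice is a poset $K$ such that every non-empty subset has a greatest lower bound (meet); it has a minimum element $\hat{0}$. If a subset of $K$ has an upper bound, then it has a least upper bound (join) $\vee$. $K$ is ranked with rank function $r:K\to\mathbb{N}$ if for all $x\in K$ every maximal chain from $\hat{0}$ to $x$ has the same length $r(x)$. An atom is an element of rank $1$. A set $A$ of atoms is independent if it has an upper bound and $r(\vee A)=|A|$. A geometric semilattice is a ranked meet semilattice such that: (G1) every element is a join of atoms ($\hat{0}$ being the empty join); (G2) the collection of independent sets of atoms is the collection of independent sets of a matroid (on the set of atoms, which is finite). *)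

theory Defs
  imports "HOL-Algebra.Lattice"
begin

section \<open>Semimatroids\<close>

locale simplicial_complex =
  fixes S :: "'a set" and C :: "'a set set"
  assumes finite_ground: "finite S"
    and subset_ground: "X \<in> C \<Longrightarrow> X \<subseteq> S"
    and down_closed: "X \<in> C \<Longrightarrow> Y \<subseteq> X \<Longrightarrow> Y \<in> C"

text \<open>The rank \<open>r\<close> is a total function of type \<open>'a set \<Rightarrow> nat\<close>, but only its values on \<open>C\<close> are
  ever used.\<close>

locale semimatroid = simplicial_complex S C
  for S :: "'a set" and C :: "'a set set" +
  fixes r :: "'a set \<Rightarrow> nat"
  assumes complex_nonempty: "C \<noteq> {}"
    and R1: "X \<in> C \<Longrightarrow> 0 \<le> r X \<and> r X \<le> card X"
    and R2: "X \<in> C \<Longrightarrow> Y \<in> C \<Longrightarrow> X \<subseteq> Y \<Longrightarrow> r X \<le> r Y"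
    and R3: "X \<in> C \<Longrightarrow> Y \<in> C \<Longrightarrow> X \<union> Y \<in> C \<Longrightarrow> r X + r Y \<ge> r (X \<union> Y) + r (X \<inter> Y)"
    and CR1: "X \<in> C \<Longrightarrow> Y \<in> C \<Longrightarrow> r X = r (X \<inter> Y) \<Longrightarrow> X \<union> Y \<in> C"
    and CR2: "X \<in> C \<Longrightarrow> Y \<in> C \<Longrightarrow> r X < r Y \<Longrightarrow> \<exists>y\<in>Y - X. X \<union> {y} \<in> C"

locale simple_semimatroid = semimatroid S C r
  for S :: "'a set" and C :: "'a set set" and r :: "'a set \<Rightarrow> nat" +
  assumes singleton_in_complex: "x \<in> S \<Longrightarrow> {x} \<in> C"
    and rank_singleton: "x \<in> S \<Longrightarrow> r {x} = 1"
    and rank_pair: "{x, y} \<in> C \<Longrightarrow> x \<noteq> y \<Longrightarrow> r {x, y} = 2"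

definition semimatroid_closure ::
    "'a set \<Rightarrow> 'a set set \<Rightarrow> ('a set \<Rightarrow> nat) \<Rightarrow> 'a set \<Rightarrow> 'a set" where
  "semimatroid_closure S C r X = {x \<in> S. X \<union> {x} \<in> C \<and> r (X \<union> {x}) = r X}"

definition flats :: "'a set \<Rightarrow> 'a set set \<Rightarrow> ('a set \<Rightarrow> nat) \<Rightarrow> 'a set set" where
  "flats S C r = {A \<in> C. semimatroid_closure S C r A = A}"

definition flat_poset :: "'a set \<Rightarrow> 'a set set \<Rightarrow> ('a set \<Rightarrow> nat) \<Rightarrow> 'a set gorder" where
  "flat_poset S C r = \<lparr>carrier = flats S C r, eq = (=), le = (\<subseteq>)\<rparr>"

lemma partial_order_flat_poset: "partial_order (flat_poset S C r)"
  by unfold_locales (auto simp: flat_poset_def)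

definition semimatroid_iso ::
    "'a set \<Rightarrow> 'a set set \<Rightarrow> ('a set \<Rightarrow> nat) \<Rightarrow> 'b set \<Rightarrow> 'b set set \<Rightarrow> ('b set \<Rightarrow> nat) \<Rightarrow> bool" where
  "semimatroid_iso S1 C1 r1 S2 C2 r2 \<longleftrightarrow>
     (\<exists>f. bij_betw f S1 S2 \<and> bij_betw (image f) C1 C2 \<and> (\<forall>c\<in>C1. r1 c = r2 (f ` c)))"


section \<open>Matroids, by independent sets\<close>

locale matroid =
  fixes E :: "'a set" and I :: "'a set set"
  assumes finite_ground: "finite E"
    and indep_subset_ground: "X \<in> I \<Longrightarrow> X \<subseteq> E"
    and indep_empty: "{} \<in> I"
    and indep_subset: "X \<in> I \<Longrightarrow> Y \<subseteq> X \<Longrightarrow> Y \<in> I"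
    and augmentation: "X \<in> I \<Longrightarrow> Y \<in> I \<Longrightarrow> card X < card Y \<Longrightarrow> \<exists>y\<in>Y - X. X \<union> {y} \<in> I"


section \<open>Geometric semilattices\<close>

definition poset_iso :: "('a, 'm) gorder_scheme \<Rightarrow> ('b, 'n) gorder_scheme \<Rightarrow> bool" where
  "poset_iso K L \<longleftrightarrow>
     (\<exists>f. bij_betw f (carrier K) (carrier L) \<and>
        (\<forall>x\<in>carrier K. \<forall>y\<in>carrier K. x \<sqsubseteq>\<^bsub>K\<^esub> y \<longleftrightarrow> f x \<sqsubseteq>\<^bsub>L\<^esub> f y))"

text \<open>Nonemptiness is what makes the meet of all elements, the minimum \<open>\<bottom>\<close>, exist.\<close>

locale meet_semilattice = partial_order K for K (structure) +
  assumes carrier_nonempty: "carrier K \<noteq> {}"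
    and meet_exists: "A \<subseteq> carrier K \<Longrightarrow> A \<noteq> {} \<Longrightarrow> \<exists>m. is_glb K m A"

text \<open>The maximal chains from \<open>\<bottom>\<close> to \<open>x\<close> are the maximal chains of the interval
  \<open>{\<bottom>..x}\<close>; the length of a chain is one less than its number of elements. The finiteness
  conjunct records that the length is a natural number.\<close>

definition rank_function :: "('k, 'm) gorder_scheme \<Rightarrow> ('k \<Rightarrow> nat) \<Rightarrow> bool" where
  "rank_function K r \<longleftrightarrow>
     (\<forall>x\<in>carrier K. \<forall>M. pred_on.maxchain \<lbrace>\<bottom>\<^bsub>K\<^esub>..x\<rbrace>\<^bsub>K\<^esub> (le K) M \<longrightarrow> finite M \<and> card M = r x + 1)"

text \<open>Maximal chains exist by the Hausdorff maximal principle, so the rank function is unique.\<close>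

lemma rank_function_unique:
  assumes "rank_function K r" "rank_function K r'" "x \<in> carrier K"
  shows "r x = r' x"
proof -
  obtain M where "pred_on.maxchain \<lbrace>\<bottom>\<^bsub>K\<^esub>..x\<rbrace>\<^bsub>K\<^esub> (le K) M"
    using pred_on.Hausdorff by blast
  with assms have "card M = r x + 1" "card M = r' x + 1"
    by (auto simp: rank_function_def)
  then show ?thesis by simp
qed

definition atoms :: "('k, 'm) gorder_scheme \<Rightarrow> ('k \<Rightarrow> nat) \<Rightarrow> 'k set" where
  "atoms K r = {a \<in> carrier K. r a = 1}"

text \<open>Finiteness of \<open>A\<close> is explicit because \<open>card\<close> is 0 on infinite sets.\<close>

definition independent_atoms :: "('k, 'm) gorder_scheme \<Rightarrow> ('k \<Rightarrow> nat) \<Rightarrow> 'k set \<Rightarrow> bool" where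
  "independent_atoms K r A \<longleftrightarrow>
     A \<subseteq> atoms K r \<and> finite A \<and> Upper K A \<noteq> {} \<and> r (\<Squnion>\<^bsub>K\<^esub>A) = card A"

definition geometric_semilattice :: "('k, 'm) gorder_scheme \<Rightarrow> bool" where
  "geometric_semilattice K \<longleftrightarrow>
     meet_semilattice K \<and>
     (\<exists>r. rank_function K r \<and>
        (\<forall>x\<in>carrier K. \<exists>A\<subseteq>atoms K r. is_lub K x A) \<and>
        matroid (atoms K r) {A. independent_atoms K r A})"

end

theory Submission
  imports Defs
begin

text \<open>In a semimatroid, the closure of \<open>X\<close> is the largest set of the complex containing \<open>X\<close> with
  the same rank. Hence flats are closed under intersection, bounded joins are closures of unions, a
  chain of flats can be refined until the rank goes up by one at each step, and (CR2) applied to the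
  closure of a union of atoms gives augmentation for independent sets of atoms.

  Conversely, the bounded sets of atoms of a geometric semilattice form the complex of a simple
  semimatroid when each is given the rank of its join. The crucial point is that an independent set
  stays independent when an atom not below its join is added and the result is bounded: independent
  sets then behave as bases, and the semimatroid axioms follow as for matroids.

  In a simple semimatroid the flats of rank one are exactly the singletons, so ground set,
  complex and rank can be read off the atoms, the bounded sets of atoms and the ranks of joins.\<close>

section \<open>Ranked posets\<close>

text \<open>Chains in \<open>pred_on\<close> compare through the reflexive closure of
  \<open>P\<close>, which a reflexive \<open>P\<close> absorbs. A larger chain contributes a single
  new element comparable with all of \<open>M\<close>, so maximality can be tested one element at a
  time.\<close>

lemma maxchain_iff:
  assumes "\<forall>x\<in>A. P x x"
  shows "pred_on.maxchain A P M \<longleftrightarrow>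
    M \<subseteq> A \<and> (\<forall>x\<in>M. \<forall>y\<in>M. P x y \<or> P y x) \<and> (\<forall>c\<in>A. (\<forall>m\<in>M. P c m \<or> P m c) \<longrightarrow> c \<in> M)"
    (is "?l \<longleftrightarrow> ?r")
proof
  assume l: ?l
  then have "pred_on.chain A P M" by (rule pred_on.maxchain_imp_chain)
  then have ch: "M \<subseteq> A" "\<forall>x\<in>M. \<forall>y\<in>M. P x y \<or> P y x"
    using assms unfolding pred_on.chain_def sup_fun_def sup_bool_def by blast+
  have "c \<in> M" if "c \<in> A" "\<forall>m\<in>M. P c m \<or> P m c" for c
  proof (rule ccontr)
    assume "c \<notin> M"
    moreover have "pred_on.chain A P (insert c M)"
      using ch that assms unfolding pred_on.chain_def sup_fun_def sup_bool_def by blast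
    moreover have "\<not> (\<exists>S. pred_on.chain A P S \<and> M \<subset> S)"
      using l unfolding pred_on.maxchain_def by (rule conjunct2)
    ultimately show False by blast
  qed
  with ch show ?r by blast
next
  assume r: ?r
  then show ?l
    unfolding pred_on.maxchain_def pred_on.chain_def sup_fun_def sup_bool_def by blast
qed

section \<open>Maximal chains of intervals and a criterion for rank functions\<close>

context partial_order
begin

lemma interval_maxchain_iff:
  "pred_on.maxchain \<lbrace>x..y\<rbrace> (\<sqsubseteq>) M \<longleftrightarrow>
    M \<subseteq> \<lbrace>x..y\<rbrace> \<and> (\<forall>u\<in>M. \<forall>v\<in>M. u \<sqsubseteq> v \<or> v \<sqsubseteq> u) \<and>
    (\<forall>c\<in>\<lbrace>x..y\<rbrace>. (\<forall>m\<in>M. c \<sqsubseteq> m \<or> m \<sqsubseteq> c) \<longrightarrow> c \<in> M)"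
  by (rule maxchain_iff) (auto simp: at_least_at_most_def)

lemma interval_maxchain_memD:
  assumes "pred_on.maxchain \<lbrace>x..y\<rbrace> (\<sqsubseteq>) M" "m \<in> M"
  shows "m \<in> carrier L" "x \<sqsubseteq> m" "m \<sqsubseteq> y"
  using subsetD[OF conjunct1[OF assms(1)[unfolded interval_maxchain_iff]] assms(2)]
  unfolding at_least_at_most_def by simp_all

lemma interval_maxchain_ends:
  assumes "pred_on.maxchain \<lbrace>x..y\<rbrace> (\<sqsubseteq>) M" "x \<in> carrier L" "y \<in> carrier L" "x \<sqsubseteq> y"
  shows "x \<in> M" "y \<in> M"
proof -
  have "x \<in> \<lbrace>x..y\<rbrace>" "y \<in> \<lbrace>x..y\<rbrace>" "\<forall>m\<in>M. x \<sqsubseteq> m" "\<forall>m\<in>M. m \<sqsubseteq> y"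
    using assms interval_maxchain_memD[OF assms(1)] by (auto simp: at_least_at_most_def)
  then show "x \<in> M" "y \<in> M"
    using assms(1) unfolding interval_maxchain_iff by blast+
qed

text \<open>An element comparable with every member of both chains is comparable with
  \<open>x\<close>, hence lies in one of the two intervals, where maximality of \<open>M\<close> or
  \<open>M'\<close> captures it.\<close>

lemma maxchain_concat:
  assumes M: "pred_on.maxchain \<lbrace>b..x\<rbrace> (\<sqsubseteq>) M" and M': "pred_on.maxchain \<lbrace>x..y\<rbrace> (\<sqsubseteq>) M'"
    and car: "b \<in> carrier L" "x \<in> carrier L" "y \<in> carrier L" and le: "b \<sqsubseteq> x" "x \<sqsubseteq> y"
  shows "pred_on.maxchain \<lbrace>b..y\<rbrace> (\<sqsubseteq>) (M \<union> M')" "M \<inter> M' = {x}"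
proof -
  have xM: "x \<in> M" "x \<in> M'"
    using interval_maxchain_ends[OF M] interval_maxchain_ends[OF M'] car le by auto
  have c1: "m \<in> carrier L \<and> b \<sqsubseteq> m \<and> m \<sqsubseteq> x" if "m \<in> M" for m
    using interval_maxchain_memD[OF M] that by auto
  have c2: "m \<in> carrier L \<and> x \<sqsubseteq> m \<and> m \<sqsubseteq> y" if "m \<in> M'" for m
    using interval_maxchain_memD[OF M'] that by auto
  have cross: "m \<sqsubseteq> m'" if "m \<in> M" "m' \<in> M'" for m m'
    using c1[OF that(1)] c2[OF that(2)] car le_trans by blast
  show "M \<inter> M' = {x}"
    using xM c1 c2 le_antisym car by blast
  have "c \<in> M \<union> M'" if c: "c \<in> \<lbrace>b..y\<rbrace>" "\<forall>m\<in>M \<union> M'. c \<sqsubseteq> m \<or> m \<sqsubseteq> c" for c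
  proof (cases "c \<sqsubseteq> x")
    case True
    then have "c \<in> \<lbrace>b..x\<rbrace>" using c(1) by (auto simp: at_least_at_most_def)
    then show ?thesis using M c(2) unfolding interval_maxchain_iff by blast
  next
    case False
    then have "c \<in> \<lbrace>x..y\<rbrace>" using c xM by (auto simp: at_least_at_most_def)
    then show ?thesis using M' c(2) unfolding interval_maxchain_iff by blast
  qed
  moreover have "M \<union> M' \<subseteq> \<lbrace>b..y\<rbrace>"
  proof
    fix m assume "m \<in> M \<union> M'"
    then have "m \<in> carrier L \<and> b \<sqsubseteq> m \<and> m \<sqsubseteq> y"
      using c1[of m] c2[of m] le_trans[OF le(1), of m] le_trans[OF _ le(2), of m] car by auto
    then show "m \<in> \<lbrace>b..y\<rbrace>" by (simp add: at_least_at_most_def)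
  qed
  moreover have "\<forall>u\<in>M \<union> M'. \<forall>v\<in>M \<union> M'. u \<sqsubseteq> v \<or> v \<sqsubseteq> u"
    using cross conjunct1[OF conjunct2[OF M[unfolded interval_maxchain_iff]]]
      conjunct1[OF conjunct2[OF M'[unfolded interval_maxchain_iff]]] by (metis Un_iff)
  ultimately show "pred_on.maxchain \<lbrace>b..y\<rbrace> (\<sqsubseteq>) (M \<union> M')"
    unfolding interval_maxchain_iff by blast
qed

lemma bottom_eq: "least L b (carrier L) \<Longrightarrow> \<bottom> = b"
  unfolding bottom_def by (meson least_unique someI)

text \<open>On a maximal chain \<open>r\<close> is injective by strict monotonicity, and no value up
  to \<open>r x\<close> is skipped, since \<open>cover\<close> would supply an element that fits
  into the gap. Hence the chain has exactly \<open>r x + 1\<close> members.\<close>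

lemma rank_functionI:
  assumes b: "least L b (carrier L)" "r b = 0"
    and mono: "\<And>x y. x \<in> carrier L \<Longrightarrow> y \<in> carrier L \<Longrightarrow> x \<sqsubseteq> y \<Longrightarrow> x \<noteq> y \<Longrightarrow> r x < r y"
    and cover: "\<And>x y. x \<in> carrier L \<Longrightarrow> y \<in> carrier L \<Longrightarrow> x \<sqsubseteq> y \<Longrightarrow> x \<noteq> y \<Longrightarrow>
      \<exists>z\<in>carrier L. x \<sqsubseteq> z \<and> z \<sqsubseteq> y \<and> r z = r x + 1"
  shows "rank_function L r"
  unfolding rank_function_def bottom_eq[OF b(1)]
proof (intro ballI allI impI)
  fix x M assume x: "x \<in> carrier L" and M: "pred_on.maxchain \<lbrace>b..x\<rbrace> (\<sqsubseteq>) M"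
  have bx: "b \<in> carrier L" "b \<sqsubseteq> x"
    using b x by (auto intro: least_le)
  have ends: "b \<in> M" "x \<in> M"
    using interval_maxchain_ends[OF M] bx x by auto
  have car: "m \<in> carrier L" "b \<sqsubseteq> m" "m \<sqsubseteq> x" if "m \<in> M" for m
    using interval_maxchain_memD[OF M] that by auto
  have total: "u \<sqsubseteq> v" if "u \<in> M" "v \<in> M" "r u \<le> r v" for u v
    using that M mono[of v u] car unfolding interval_maxchain_iff
    by (metis le_refl not_le)
  have inj: "inj_on r M"
    using total car by (intro inj_onI) (metis le_antisym order_refl)
  have "r ` M = {..r x}"
  proof
    show "r ` M \<subseteq> {..r x}"
      using car mono x by (auto simp: less_imp_le) (metis less_imp_le order_refl)
    show "{..r x} \<subseteq> r ` M"
    proof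
      fix k assume k: "k \<in> {..r x}"
      show "k \<in> r ` M"
      proof (rule ccontr)
        assume nk: "k \<notin> r ` M"
        \<comment> \<open>Around a skipped value \<open>k\<close>, \<open>a\<close> is the member of
          greatest rank below \<open>k\<close> and \<open>y\<close> one of least rank above it. The
          element \<open>z\<close> one rank above \<open>a\<close> and below \<open>y\<close> is
          comparable with all of \<open>M\<close>, so it belongs to \<open>M\<close>. Its rank
          \<open>r a + 1\<close> is at most \<open>k\<close>, hence below \<open>k\<close>, against
          the choice of \<open>a\<close>.\<close>
        define A where "A = {n \<in> r ` M. n < k}"
        have "0 \<in> A" using ends b(2) nk unfolding A_def by force
        moreover have fA: "finite A" by (auto simp: A_def)
        ultimately have "Max A \<in> A" by (metis Max_in empty_iff)
        then obtain a where a: "a \<in> M" "r a < k" "r a = Max A"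
          by (auto simp: A_def)
        have amax: "m \<sqsubseteq> a" if "m \<in> M" "r m < k" for m
          using that a fA by (intro total) (auto simp: A_def)
        have kx: "k < r x" using k nk ends by (metis atMost_iff imageI le_neq_implies_less)
        define y where "y = arg_min r (\<lambda>m. m \<in> M \<and> k < r m)"
        have y: "y \<in> M" "k < r y" and ymin: "\<And>m. m \<in> M \<Longrightarrow> k < r m \<Longrightarrow> r y \<le> r m"
          using arg_min_nat_lemma[of "\<lambda>m. m \<in> M \<and> k < r m" x r] ends kx by (auto simp: y_def)
        have "a \<sqsubseteq> y" "a \<noteq> y" using total a y by auto
        then obtain z where z: "z \<in> carrier L" "a \<sqsubseteq> z" "z \<sqsubseteq> y" "r z = r a + 1"
          using cover[of a y] a y car by auto
        have "z \<in> \<lbrace>b..x\<rbrace>"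
          using z car[OF a(1)] car[OF y(1)] x bx le_trans unfolding at_least_at_most_def by blast
        moreover have "z \<sqsubseteq> m \<or> m \<sqsubseteq> z" if m: "m \<in> M" for m
        proof (cases "r m < k")
          case True
          then show ?thesis using amax[OF m] z car[OF m] car[OF a(1)] le_trans by blast
        next
          case False
          then have "k < r m" using nk m by (metis imageI linorder_neqE_nat)
          then have "y \<sqsubseteq> m" using ymin[OF m] total[OF y(1) m] by auto
          then show ?thesis using z car[OF m] car[OF y(1)] le_trans by blast
        qed
        ultimately have zM: "z \<in> M" using M unfolding interval_maxchain_iff by blast
        then have "r z < k" using z a nk by (metis Suc_eq_plus1 Suc_leI imageI le_neq_implies_less)
        then have "z \<sqsubseteq> a" using amax zM by blast
        then have "z = a" using z a car le_antisym by blast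
        then show False using z by auto
      qed
    qed
  qed
  then show "finite M \<and> card M = r x + 1"
    using inj by (metis card_atMost card_image finite_atMost finite_imageD Suc_eq_plus1)
qed

end

section \<open>Rank increments in a ranked meet semilattice\<close>

locale ranked_semilattice = meet_semilattice K for K (structure) +
  fixes r :: "'a \<Rightarrow> nat"
  assumes rank_function: "rank_function K r"
begin

lemma bottom_least: "least K \<bottom> (carrier K)"
proof -
  obtain m where "is_glb K m (carrier K)"
    using meet_exists[of "carrier K"] carrier_nonempty by auto
  then have "least K m (carrier K)"
    unfolding greatest_def least_def Lower_def by blast
  then show ?thesis using bottom_eq by auto
qed

lemma bottom_closed [simp]: "\<bottom> \<in> carrier K"
  and bottom_le [simp]: "x \<in> carrier K \<Longrightarrow> \<bottom> \<sqsubseteq> x"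
  using bottom_least by (auto simp: least_def)

text \<open>A maximal chain from \<open>\<bottom>\<close> to \<open>x\<close> followed by
  \<open>M'\<close> is a maximal chain from \<open>\<bottom>\<close> to \<open>y\<close>. The two
  share only \<open>x\<close>, so the length of \<open>M'\<close>, one less than its cardinality, is
  \<open>r y - r x\<close>.\<close>

lemma rank_interval:
  assumes "x \<in> carrier K" "y \<in> carrier K" "x \<sqsubseteq> y" and M': "pred_on.maxchain \<lbrace>x..y\<rbrace> (\<sqsubseteq>) M'"
  shows "finite M'" "r y + 1 = r x + card M'"
proof -
  obtain M where M: "pred_on.maxchain \<lbrace>\<bottom>..x\<rbrace> (\<sqsubseteq>) M"
    using pred_on.Hausdorff by blast
  note c = maxchain_concat[OF M M' _ assms(1,2) _ assms(3)]
  have "finite (M \<union> M')" "card (M \<union> M') = r y + 1" "card M = r x + 1"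
    using rank_function c(1) M assms(1,2) unfolding rank_function_def by auto
  moreover have "card (M \<union> M') + card (M \<inter> M') = card M + card M'"
    using calculation(1) card_Un_Int[of M M'] by simp
  ultimately show "finite M'" "r y + 1 = r x + card M'"
    using c(2) assms by auto
qed

lemma rank_less:
  assumes "x \<in> carrier K" "y \<in> carrier K" "x \<sqsubseteq> y" "x \<noteq> y"
  shows "r x < r y"
proof -
  obtain M where M: "pred_on.maxchain \<lbrace>x..y\<rbrace> (\<sqsubseteq>) M"
    using pred_on.Hausdorff by blast
  have "{x, y} \<subseteq> M" using interval_maxchain_ends[OF M] assms by auto
  then have "card {x, y} \<le> card M" using rank_interval[OF _ _ _ M] assms card_mono by blast
  then show ?thesis using rank_interval[OF _ _ _ M] assms by auto
qed

lemma rank_le: "x \<in> carrier K \<Longrightarrow> y \<in> carrier K \<Longrightarrow> x \<sqsubseteq> y \<Longrightarrow> r x \<le> r y"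
  using rank_less by (metis less_imp_le order_refl)

text \<open>An element \<open>z\<close> of least rank among those strictly above \<open>x\<close>
  and at most \<open>y\<close> covers \<open>x\<close>, so \<open>{x, z}\<close> is a maximal chain
  of its interval and \<open>rank_interval\<close> gives the increment.\<close>

lemma rank_cover:
  assumes "x \<in> carrier K" "y \<in> carrier K" "x \<sqsubseteq> y" "x \<noteq> y"
  obtains z where "z \<in> carrier K" "x \<sqsubseteq> z" "z \<sqsubseteq> y" "r z = r x + 1"
proof -
  define P where "P z \<longleftrightarrow> z \<in> carrier K \<and> x \<sqsubseteq> z \<and> z \<sqsubseteq> y \<and> x \<noteq> z" for z
  have "P y" using assms by (auto simp: P_def)
  define z where "z = arg_min r P"
  have z: "P z" and zmin: "\<And>w. P w \<Longrightarrow> r z \<le> r w"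
    using arg_min_nat_lemma[of P y r] \<open>P y\<close> by (auto simp: z_def)
  have "c \<in> {x, z}" if c: "c \<in> \<lbrace>x..z\<rbrace>" for c
  proof (rule ccontr)
    assume "c \<notin> {x, z}"
    moreover have "P c"
      using c z assms calculation le_trans unfolding P_def at_least_at_most_def by blast
    ultimately show False
      using zmin[of c] rank_less[of c z] c z by (auto simp: P_def at_least_at_most_def)
  qed
  then have "pred_on.maxchain \<lbrace>x..z\<rbrace> (\<sqsubseteq>) {x, z}"
    using z assms unfolding interval_maxchain_iff by (auto simp: P_def at_least_at_most_def)
  then have "r z = r x + 1"
    using rank_interval(2)[of x z "{x, z}"] z assms by (auto simp: P_def)
  then show thesis using that z by (auto simp: P_def)
qed

end

section \<open>Flats of a semimatroid\<close>

context semimatroid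
begin

abbreviation cl :: "'a set \<Rightarrow> 'a set" where "cl \<equiv> semimatroid_closure S C r"

lemma empty_in_complex: "{} \<in> C"
  using complex_nonempty down_closed by blast

text \<open>\<open>r (A \<inter> B)\<close> is squeezed between \<open>r X\<close> and
  \<open>r A\<close>; then (CR1) puts the union in the complex and (R3) bounds its rank.\<close>

lemma rank_Un_same:
  assumes "X \<subseteq> A" "X \<subseteq> B" "A \<in> C" "B \<in> C" "r A = r X" "r B = r X"
  shows "A \<union> B \<in> C" "r (A \<union> B) = r X"
proof -
  have c: "X \<in> C" "A \<inter> B \<in> C" using assms down_closed[of A] by auto
  have "r X \<le> r (A \<inter> B)" "r (A \<inter> B) \<le> r A" using R2[of X "A \<inter> B"] R2[of "A \<inter> B" A] c assms by auto
  then have e: "r (A \<inter> B) = r X" using assms by simp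
  then show u: "A \<union> B \<in> C" using CR1 assms by simp
  have "r A \<le> r (A \<union> B)" using R2[of A "A \<union> B"] u assms by auto
  then show "r (A \<union> B) = r X" using R3[of A B] u e assms by auto
qed

lemma closure_extensive: "X \<in> C \<Longrightarrow> X \<subseteq> cl X"
  using subset_ground unfolding semimatroid_closure_def by (auto simp: insert_absorb)

text \<open>The elements of \<open>cl X\<close> are added to \<open>X\<close> one at a time. By
  \<open>rank_Un_same\<close> each stage stays in the complex with rank \<open>r X\<close>, and
  finiteness of the ground set lets this reach \<open>cl X\<close>.\<close>

lemma closure_in_complex: "X \<in> C \<Longrightarrow> cl X \<in> C"
  and rank_closure: "X \<in> C \<Longrightarrow> r (cl X) = r X"
proof -
  assume X: "X \<in> C"
  have "X \<union> T \<in> C \<and> r (X \<union> T) = r X" if "finite T" "T \<subseteq> cl X" for T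
    using that
  proof (induction T)
    case empty
    then show ?case using X by simp
  next
    case (insert t T)
    have "X \<union> {t} \<in> C" "r (X \<union> {t}) = r X"
      using insert.prems by (auto simp: semimatroid_closure_def)
    then have "(X \<union> T) \<union> (X \<union> {t}) \<in> C \<and> r ((X \<union> T) \<union> (X \<union> {t})) = r X"
      using rank_Un_same[of X "X \<union> T" "X \<union> {t}"] insert by auto
    moreover have "(X \<union> T) \<union> (X \<union> {t}) = X \<union> insert t T" by auto
    ultimately show ?case by simp
  qed
  moreover have "cl X \<subseteq> S" by (auto simp: semimatroid_closure_def)
  moreover have "X \<union> cl X = cl X" using closure_extensive X by auto
  ultimately show "cl X \<in> C" "r (cl X) = r X"
    using finite_ground finite_subset by (metis order_refl)+
qed

lemma closure_maximal:
  assumes "X \<subseteq> Y" "Y \<in> C" "r Y = r X"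
  shows "Y \<subseteq> cl X"
proof
  fix y assume y: "y \<in> Y"
  have c: "X \<in> C" "X \<union> {y} \<in> C" using assms y down_closed[of Y] by auto
  have "r X \<le> r (X \<union> {y})" "r (X \<union> {y}) \<le> r Y" using R2[of X "X \<union> {y}"] R2[of "X \<union> {y}" Y] c assms y by auto
  then show "y \<in> cl X"
    using c assms y subset_ground by (auto simp: semimatroid_closure_def)
qed

text \<open>For \<open>x\<close> in \<open>cl X\<close> the sets \<open>X \<union> {x}\<close> and
  \<open>(X \<union> {x}) \<inter> Y\<close> have the same rank, so (CR1) puts
  \<open>Y \<union> {x}\<close> in the complex and (R3) shows that \<open>x\<close> does not raise
  the rank of \<open>Y\<close>.\<close>

lemma closure_mono:
  assumes "X \<subseteq> Y" "Y \<in> C"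
  shows "cl X \<subseteq> cl Y"
proof
  fix x assume x: "x \<in> cl X"
  have X: "X \<in> C" using assms down_closed by auto
  have xX: "X \<union> {x} \<in> C" "r (X \<union> {x}) = r X" using x by (auto simp: semimatroid_closure_def)
  have i: "(X \<union> {x}) \<inter> Y \<in> C" using assms(2) down_closed by auto
  have "r X \<le> r ((X \<union> {x}) \<inter> Y)" "r ((X \<union> {x}) \<inter> Y) \<le> r (X \<union> {x})"
    using R2[of X "(X \<union> {x}) \<inter> Y"] R2[of "(X \<union> {x}) \<inter> Y" "X \<union> {x}"] X i xX assms by auto
  then have e: "r (X \<union> {x}) = r ((X \<union> {x}) \<inter> Y)" using xX by simp
  have eq: "(X \<union> {x}) \<union> Y = Y \<union> {x}" using assms by auto
  have u: "Y \<union> {x} \<in> C" using CR1[OF xX(1) assms(2) e] eq by simp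
  have "r (Y \<union> {x}) \<le> r Y" using R3[of "X \<union> {x}" Y] xX assms u e eq by auto
  moreover have "r Y \<le> r (Y \<union> {x})" using R2[of Y "Y \<union> {x}"] u assms by auto
  ultimately show "x \<in> cl Y"
    using u x by (auto simp: semimatroid_closure_def)
qed

lemma flat_in_complex: "A \<in> flats S C r \<Longrightarrow> A \<in> C"
  and closure_flat: "A \<in> flats S C r \<Longrightarrow> cl A = A"
  by (auto simp: flats_def)

lemma closure_is_flat:
  assumes "X \<in> C"
  shows "cl X \<in> flats S C r"
proof -
  have c: "cl X \<in> C" "r (cl X) = r X" using closure_in_complex rank_closure assms by auto
  have "cl (cl X) \<subseteq> cl X"
    using closure_maximal[of X "cl (cl X)"] c closure_in_complex rank_closure
      closure_extensive[OF assms] closure_extensive[OF c(1)] by auto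
  then show ?thesis using c closure_extensive[OF c(1)] by (auto simp: flats_def)
qed

lemma closure_least: "X \<subseteq> A \<Longrightarrow> A \<in> flats S C r \<Longrightarrow> cl X \<subseteq> A"
  using closure_mono[of X A] flat_in_complex closure_flat by auto

lemma Inter_flats:
  assumes "\<A> \<subseteq> flats S C r" "\<A> \<noteq> {}"
  shows "\<Inter>\<A> \<in> flats S C r"
proof -
  obtain A where A: "A \<in> \<A>" using assms by auto
  then have c: "\<Inter>\<A> \<in> C" using assms flat_in_complex down_closed[of A "\<Inter>\<A>"] by auto
  have "cl (\<Inter>\<A>) \<subseteq> B" if "B \<in> \<A>" for B
    using closure_least[of "\<Inter>\<A>" B] that assms by auto
  then have "cl (\<Inter>\<A>) \<subseteq> \<Inter>\<A>" by blast
  then show ?thesis using closure_extensive[OF c] c by (auto simp: flats_def)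
qed

section \<open>Ranks of unions and rank growth between flats\<close>

lemma rank_empty: "r {} = 0"
  using R1[OF empty_in_complex] by simp

lemma rank_Un_le:
  assumes "X \<in> C" "Y \<in> C" "X \<union> Y \<in> C"
  shows "r (X \<union> Y) \<le> r X + r Y"
  using R3[OF assms] by simp

lemma rank_less_flat:
  assumes "A \<in> flats S C r" "B \<in> C" "A \<subset> B"
  shows "r A < r B"
proof (rule ccontr)
  assume "\<not> r A < r B"
  then have "r B = r A" using R2[of A B] assms flat_in_complex by auto
  then show False using closure_maximal[of A B] assms closure_flat by auto
qed

lemma rank_insert_flat:
  assumes "A \<in> flats S C r" "A \<union> {x} \<in> C" "x \<notin> A"
  shows "r (A \<union> {x}) = r A + 1"
proof -
  have x: "{x} \<in> C" using assms(2) down_closed by auto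
  have "r (A \<union> {x}) \<le> r A + r {x}"
    using rank_Un_le[of A "{x}"] assms x flat_in_complex[OF assms(1)] by auto
  moreover have "r {x} \<le> 1" using R1[OF x] by simp
  moreover have "r A < r (A \<union> {x})" using rank_less_flat assms by auto
  ultimately show ?thesis by simp
qed

text \<open>Supplies the \<open>cover\<close> hypothesis of \<open>rank_functionI\<close>: one
  further element of \<open>B\<close> raises the rank of the flat \<open>A\<close> by exactly one,
  and taking the closure keeps that rank.\<close>

lemma flat_cover:
  assumes "A \<in> flats S C r" "B \<in> flats S C r" "A \<subset> B"
  shows "\<exists>D\<in>flats S C r. A \<subseteq> D \<and> D \<subseteq> B \<and> r D = r A + 1"
proof -
  obtain x where x: "x \<in> B" "x \<notin> A" using assms by auto
  have c: "A \<union> {x} \<in> C" using down_closed[of B] flat_in_complex assms x by auto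
  have "cl (A \<union> {x}) \<subseteq> B" using closure_least assms x by auto
  moreover have "A \<subseteq> cl (A \<union> {x})" using closure_extensive[OF c] by auto
  ultimately show ?thesis
    using closure_is_flat[OF c] rank_closure[OF c] rank_insert_flat[OF assms(1) c x(2)] by auto
qed

text \<open>Elements of rank zero (loops) lie in \<open>cl {}\<close> and thus in every flat, so
  only elements of rank one distinguish flats. This is what makes flats joins of atoms even when
  there are loops.\<close>

lemma flat_subset_if_nonloops:
  assumes "A \<in> flats S C r" "B \<in> flats S C r"
    and nonloop: "\<And>x. {x} \<in> C \<Longrightarrow> r {x} = 1 \<Longrightarrow> x \<in> A \<Longrightarrow> x \<in> B"
  shows "A \<subseteq> B"
proof
  fix x assume x: "x \<in> A"
  have c: "{x} \<in> C" using x assms(1) flat_in_complex down_closed[of A "{x}"] by auto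
  show "x \<in> B"
  proof (cases "r {x} = 0")
    case True
    then have "x \<in> cl {}"
      using c rank_empty subset_ground by (auto simp: semimatroid_closure_def)
    then show ?thesis using closure_least[of "{}" B] assms by auto
  next
    case False
    then have "r {x} = 1" using R1[OF c] by simp
    then show ?thesis using nonloop c x by auto
  qed
qed

end

section \<open>Posets isomorphic to the poset of flats of a semimatroid\<close>

text \<open>The isomorphism \<open>F\<close> onto the flats is fixed as a parameter, so that bounds,
  joins and ranks in \<open>K\<close> can be computed with sets.\<close>

locale flat_representation = partial_order K + semimatroid S C r
  for K (structure) and S :: "'a set" and C and r +
  fixes F :: "'k \<Rightarrow> 'a set"
  assumes bij: "bij_betw F (carrier K) (flats S C r)"
    and le_iff: "x \<in> carrier K \<Longrightarrow> y \<in> carrier K \<Longrightarrow> x \<sqsubseteq> y \<longleftrightarrow> F x \<subseteq> F y"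
begin

abbreviation rk :: "'k \<Rightarrow> nat" where "rk x \<equiv> r (F x)"

lemma F_flat: "x \<in> carrier K \<Longrightarrow> F x \<in> flats S C r"
  using bij by (auto simp: bij_betw_def)

lemma F_in_complex: "x \<in> carrier K \<Longrightarrow> F x \<in> C"
  using F_flat flat_in_complex by blast

lemma F_inj: "x \<in> carrier K \<Longrightarrow> y \<in> carrier K \<Longrightarrow> F x = F y \<Longrightarrow> x = y"
  using bij by (auto simp: bij_betw_def inj_on_def)

lemma F_surj:
  assumes "A \<in> flats S C r"
  obtains x where "x \<in> carrier K" "F x = A"
proof -
  have "A \<in> F ` carrier K" using bij assms by (simp add: bij_betw_def)
  then show thesis using that by (elim imageE) simp
qed

lemma finite_carrier: "finite (carrier K)"
proof -
  have "flats S C r \<subseteq> Pow S" using flat_in_complex subset_ground by auto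
  then show ?thesis using bij finite_ground bij_betw_finite finite_subset by blast
qed

lemma meet_semilattice: "meet_semilattice K"
proof
  show "carrier K \<noteq> {}"
    using F_surj[OF closure_is_flat[OF empty_in_complex]] by auto
next
  fix A assume A: "A \<subseteq> carrier K" "A \<noteq> {}"
  then have "\<Inter>(F ` A) \<in> flats S C r"
    using Inter_flats[of "F ` A"] F_flat by auto
  then obtain m where m: "m \<in> carrier K" "F m = \<Inter>(F ` A)" by (rule F_surj)
  have "is_glb K m A"
  proof (rule greatest_LowerI)
    show "m \<sqsubseteq> x" if "x \<in> A" for x
      using m that A by (auto simp: le_iff subset_iff)
    show "y \<sqsubseteq> m" if "y \<in> Lower K A" for y
    proof -
      have y: "y \<in> carrier K" "\<forall>x\<in>A. y \<sqsubseteq> x"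
        using that A unfolding Lower_def by auto
      then have "\<forall>x\<in>A. F y \<subseteq> F x" using A le_iff by (metis subsetD)
      then show ?thesis using m y le_iff by (simp add: INF_greatest)
    qed
  qed (use A m in auto)
  then show "\<exists>m. is_glb K m A" ..
qed

lemma rank_function: "rank_function K rk"
proof -
  obtain b where b: "b \<in> carrier K" "F b = cl {}"
    using F_surj[OF closure_is_flat[OF empty_in_complex]] .
  show ?thesis
  proof (rule rank_functionI)
    have "F b \<subseteq> F x" if "x \<in> carrier K" for x
      using closure_least[of "{}" "F x"] b F_flat that by auto
    then show "least K b (carrier K)"
      using b le_iff by (auto simp: least_def)
    show "rk b = 0" using b rank_closure empty_in_complex rank_empty by simp
  next
    fix x y assume xy: "x \<in> carrier K" "y \<in> carrier K" "x \<sqsubseteq> y" "x \<noteq> y"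
    then have s: "F x \<subset> F y" using le_iff F_inj by blast
    then show "rk x < rk y" using rank_less_flat xy F_flat F_in_complex by blast
    obtain D where D: "D \<in> flats S C r" "F x \<subseteq> D" "D \<subseteq> F y" "r D = rk x + 1"
      using flat_cover s xy F_flat by metis
    then obtain z where "z \<in> carrier K" "F z = D" using F_surj by blast
    then show "\<exists>z\<in>carrier K. x \<sqsubseteq> z \<and> z \<sqsubseteq> y \<and> rk z = rk x + 1"
      using D xy le_iff by blast
  qed
qed

section \<open>Bounded sets and joins in terms of unions of flats\<close>

lemma Upper_iff:
  assumes "A \<subseteq> carrier K"
  shows "u \<in> Upper K A \<longleftrightarrow> u \<in> carrier K \<and> \<Union>(F ` A) \<subseteq> F u"
proof -
  have "u \<in> Upper K A \<longleftrightarrow> u \<in> carrier K \<and> (\<forall>x\<in>A. x \<sqsubseteq> u)"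
    using assms unfolding Upper_def by auto
  also have "\<dots> \<longleftrightarrow> u \<in> carrier K \<and> (\<forall>x\<in>A. F x \<subseteq> F u)"
    using assms le_iff by (metis subsetD)
  finally show ?thesis by (simp add: UN_subset_iff)
qed

lemma bounded_iff:
  assumes "A \<subseteq> carrier K"
  shows "Upper K A \<noteq> {} \<longleftrightarrow> \<Union>(F ` A) \<in> C"
proof
  assume "Upper K A \<noteq> {}"
  then obtain u where "u \<in> Upper K A" by auto
  then show "\<Union>(F ` A) \<in> C"
    using Upper_iff[OF assms] F_in_complex[of u] down_closed[of "F u"] by simp
next
  assume c: "\<Union>(F ` A) \<in> C"
  obtain u where "u \<in> carrier K" "F u = cl (\<Union>(F ` A))" using F_surj[OF closure_is_flat[OF c]] .
  then have "u \<in> Upper K A" using closure_extensive[OF c] Upper_iff[OF assms, of u] by simp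
  then show "Upper K A \<noteq> {}" by auto
qed

lemma Sup_closed: "A \<subseteq> carrier K \<Longrightarrow> \<Union>(F ` A) \<in> C \<Longrightarrow> \<Squnion>A \<in> carrier K"
  and F_Sup: "A \<subseteq> carrier K \<Longrightarrow> \<Union>(F ` A) \<in> C \<Longrightarrow> F (\<Squnion>A) = cl (\<Union>(F ` A))"
proof -
  assume A: "A \<subseteq> carrier K" "\<Union>(F ` A) \<in> C"
  obtain j where j: "j \<in> carrier K" "F j = cl (\<Union>(F ` A))"
    using F_surj[OF closure_is_flat[OF A(2)]] .
  have "is_lub K j A"
    unfolding least_def
  proof (intro conjI ballI)
    show "j \<in> Upper K A" using j Upper_iff A closure_extensive by auto
    show "j \<sqsubseteq> u" if "u \<in> Upper K A" for u
      using that closure_least[of _ "F u"] j Upper_iff[OF A(1)] F_flat le_iff by auto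
  qed auto
  \<comment> \<open>\<open>\<Squnion>\<close> picks some least upper bound by \<open>SOME\<close>;
    uniqueness identifies it with \<open>j\<close>.\<close>
  then have "\<Squnion>A = j" unfolding sup_def using least_unique by (metis someI_ex)
  then show "\<Squnion>A \<in> carrier K" "F (\<Squnion>A) = cl (\<Union>(F ` A))" using j by auto
qed

lemma rank_Sup: "A \<subseteq> carrier K \<Longrightarrow> \<Union>(F ` A) \<in> C \<Longrightarrow> rk (\<Squnion>A) = r (\<Union>(F ` A))"
  by (simp add: F_Sup rank_closure)

section \<open>The matroid of atoms\<close>

lemma atoms_iff: "a \<in> atoms K rk \<longleftrightarrow> a \<in> carrier K \<and> rk a = 1"
  by (simp add: atoms_def)

text \<open>The join of \<open>A\<close> corresponds to the closure of the union of its flats, which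
  has the rank of the union. Independence thus becomes a condition on subsets of \<open>S\<close>,
  to which the semimatroid axioms apply.\<close>

lemma independent_atoms_iff:
  "independent_atoms K rk A \<longleftrightarrow>
    A \<subseteq> atoms K rk \<and> \<Union>(F ` A) \<in> C \<and> r (\<Union>(F ` A)) = card A"
proof -
  have "finite A" if "A \<subseteq> atoms K rk"
    using that finite_subset[OF _ finite_carrier] by (auto simp: atoms_def)
  moreover have "A \<subseteq> carrier K" if "A \<subseteq> atoms K rk"
    using that by (auto simp: atoms_def)
  ultimately show ?thesis
    unfolding independent_atoms_def using bounded_iff[of A] rank_Sup[of A] by metis
qed

text \<open>Each atom raises the rank by at most one. With \<open>X = {}\<close> this bounds the
  rank of a set of atoms by its size; with \<open>X\<close> the union of some of the atoms it bounds
  the contribution of the others.\<close>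

lemma rank_Union_atoms_le:
  assumes "finite B" "B \<subseteq> atoms K rk" "X \<union> \<Union>(F ` B) \<in> C"
  shows "r (X \<union> \<Union>(F ` B)) \<le> r X + card B"
  using assms
proof (induction B)
  case empty
  then show ?case by simp
next
  case (insert b B)
  have eq: "X \<union> \<Union>(F ` insert b B) = (X \<union> \<Union>(F ` B)) \<union> F b" by auto
  have c: "X \<union> \<Union>(F ` B) \<in> C" "F b \<in> C"
    using insert.prems down_closed[of "X \<union> \<Union>(F ` insert b B)"] by auto
  have "r (X \<union> \<Union>(F ` insert b B)) \<le> r (X \<union> \<Union>(F ` B)) + rk b"
    using rank_Un_le[OF c] insert.prems(2) eq by simp
  then show ?case using insert c by (simp add: atoms_iff)
qed

text \<open>Every element \<open>s\<close> of rank one in \<open>F x\<close> lies in the atom with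
  flat \<open>cl {s}\<close>, which is below \<open>x\<close>. An upper bound of these atoms
  therefore contains all non-loops of \<open>F x\<close>.\<close>

lemma lub_of_atoms:
  assumes x: "x \<in> carrier K"
  shows "is_lub K x {a \<in> atoms K rk. a \<sqsubseteq> x}"
proof (rule least_UpperI)
  fix u assume u: "u \<in> Upper K {a \<in> atoms K rk. a \<sqsubseteq> x}"
  then have uc: "u \<in> carrier K" by (auto simp: Upper_def)
  have "F x \<subseteq> F u"
  proof (rule flat_subset_if_nonloops)
    fix s assume s: "{s} \<in> C" "r {s} = 1" "s \<in> F x"
    obtain a where a: "a \<in> carrier K" "F a = cl {s}" using F_surj[OF closure_is_flat[OF s(1)]] .
    have "a \<in> atoms K rk" using a rank_closure s by (simp add: atoms_iff)
    moreover have "a \<sqsubseteq> x" using closure_least[of "{s}" "F x"] F_flat a x s le_iff by auto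
    ultimately have "a \<sqsubseteq> u" using u a by (auto simp: Upper_def)
    then show "s \<in> F u" using a uc le_iff closure_extensive[OF s(1)] by auto
  qed (use x uc F_flat in auto)
  then show "x \<sqsubseteq> u" using x uc le_iff by simp
qed (use x in \<open>auto simp: atoms_iff\<close>)

lemma matroid_atoms: "matroid (atoms K rk) {A. independent_atoms K rk A}"
proof
  show fin: "finite (atoms K rk)" using finite_carrier by (simp add: atoms_def)
  show "X \<subseteq> atoms K rk" if "X \<in> {A. independent_atoms K rk A}" for X
    using that by (simp add: independent_atoms_iff)
  show "{} \<in> {A. independent_atoms K rk A}"
    using empty_in_complex rank_empty by (simp add: independent_atoms_iff)
  show "Y \<in> {A. independent_atoms K rk A}"
    if X: "X \<in> {A. independent_atoms K rk A}" and YX: "Y \<subseteq> X" for X Y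
  proof -
    have a: "X \<subseteq> atoms K rk" "\<Union>(F ` X) \<in> C" "r (\<Union>(F ` X)) = card X"
      using X by (auto simp: independent_atoms_iff)
    then have finX: "finite X" using fin finite_subset by blast
    have Yc: "\<Union>(F ` Y) \<in> C" using a(2) YX down_closed[OF a(2) Union_mono] by (meson image_mono)
    \<comment> \<open>The atoms of \<open>X - Y\<close> contribute at most
      \<open>card (X - Y)\<close> and those of \<open>Y\<close> at most \<open>card Y\<close>. The
      total is \<open>card X\<close>, so both bounds are attained.\<close>
    have X1: "\<Union>(F ` X) = \<Union>(F ` Y) \<union> \<Union>(F ` (X - Y))" using YX by auto
    have "r (\<Union>(F ` X)) \<le> r (\<Union>(F ` Y)) + card (X - Y)"
      unfolding X1 using rank_Union_atoms_le[of "X - Y" "\<Union>(F ` Y)"] finX a X1 by auto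
    moreover have "r (\<Union>(F ` Y)) \<le> card Y"
      using rank_Union_atoms_le[of Y "{}"] Yc a YX rank_empty finite_subset[OF YX finX] by auto
    moreover have "card X = card Y + card (X - Y)"
      using YX finX by (metis card_Diff_subset card_mono finite_subset le_add_diff_inverse)
    ultimately have "r (\<Union>(F ` Y)) = card Y" using a by simp
    then show ?thesis using a Yc YX by (auto simp: independent_atoms_iff)
  qed
  show "\<exists>y\<in>Y - X. X \<union> {y} \<in> {A. independent_atoms K rk A}"
    if X: "X \<in> {A. independent_atoms K rk A}" and Y: "Y \<in> {A. independent_atoms K rk A}"
      and less: "card X < card Y" for X Y
  proof -
    define U where "U = \<Union>(F ` X)"
    define V where "V = \<Union>(F ` Y)"
    have XU: "X \<subseteq> atoms K rk" "U \<in> C" "r U = card X"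
      and YV: "Y \<subseteq> atoms K rk" "V \<in> C" "r V = card Y"
      using X Y by (auto simp: independent_atoms_iff U_def V_def)
    have clU: "cl U \<in> flats S C r" "r (cl U) = r U" "U \<subseteq> cl U"
      using closure_is_flat rank_closure closure_extensive XU by auto
    \<comment> \<open>(CR2) is applied to \<open>cl U\<close> rather than \<open>U\<close>, because
      an element outside this flat raises the rank by exactly one.\<close>
    obtain y where y: "y \<in> V" "y \<notin> cl U" "cl U \<union> {y} \<in> C"
      using CR2[of "cl U" V] clU XU YV less flat_in_complex by auto
    have ry: "r (cl U \<union> {y}) = card X + 1"
      using rank_insert_flat[OF clU(1) y(3,2)] clU XU by simp
    obtain a where a: "a \<in> Y" "y \<in> F a" using y by (auto simp: V_def)
    have aK: "a \<in> carrier K" "rk a = 1" using a YV by (auto simp: atoms_iff)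
    have aX: "a \<notin> X" using a(2) y(2) clU(3) by (auto simp: U_def)
    \<comment> \<open>Being outside \<open>cl U\<close>, \<open>y\<close> is not a loop, so
      \<open>{y}\<close> has the rank of the atom \<open>a\<close> containing it. Hence
      \<open>F a\<close> lies in the closure of \<open>y\<close>, and adding \<open>y\<close>
      amounts to adding the whole atom.\<close>
    have Fa: "F a \<subseteq> cl {y}"
    proof (rule closure_maximal)
      have c: "{y} \<in> C" using y(3) down_closed by auto
      have "y \<notin> cl {}" using y(2) closure_mono[of "{}" U] XU by auto
      then have "r {y} \<noteq> 0"
        using c rank_empty subset_ground by (auto simp: semimatroid_closure_def)
      moreover have "r {y} \<le> 1" using R1[OF c] by simp
      ultimately show "rk a = r {y}" using aK by simp
    qed (use a aK F_in_complex in auto)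
    \<comment> \<open>Each of \<open>W\<close> and \<open>U \<union> F a\<close> lies in the closure
      of the other. One inclusion puts \<open>U \<union> F a\<close> in the complex and bounds its
      rank above by \<open>card X + 1\<close>, the other bounds it below.\<close>
    define W where "W = cl U \<union> {y}"
    have W: "W \<in> C" "cl U \<subseteq> W" using y by (auto simp: W_def)
    have UF: "U \<union> F a \<subseteq> cl W"
      using Fa closure_mono[of "{y}" W] W clU closure_extensive[OF W(1)] by (auto simp: W_def)
    then have c: "U \<union> F a \<in> C" using closure_in_complex[OF W(1)] down_closed by blast
    have "r (U \<union> F a) \<le> card X + 1"
      using R2[OF c closure_in_complex[OF W(1)] UF] rank_closure[OF W(1)] ry by (simp add: W_def)
    moreover have "W \<subseteq> cl (U \<union> F a)"
      using closure_mono[of U "U \<union> F a"] closure_extensive[OF c] c a by (auto simp: W_def)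
    then have "r W \<le> r (cl (U \<union> F a))" using R2 W closure_in_complex c by auto
    then have "card X + 1 \<le> r (U \<union> F a)" using ry rank_closure[OF c] by (simp add: W_def)
    moreover have "finite X" using XU fin finite_subset by blast
    ultimately have "r (\<Union>(F ` (X \<union> {a}))) = card (X \<union> {a})" "\<Union>(F ` (X \<union> {a})) \<in> C"
      using aX c by (auto simp: U_def Un_commute)
    then show ?thesis using a aX XU YV by (auto simp: independent_atoms_iff)
  qed
qed

lemma geometric_semilattice: "geometric_semilattice K"
  unfolding geometric_semilattice_def
proof (intro conjI exI[of _ rk] ballI)
  fix x assume "x \<in> carrier K"
  then show "\<exists>A\<subseteq>atoms K rk. is_lub K x A"
    using lub_of_atoms by (intro exI[of _ "{a \<in> atoms K rk. a \<sqsubseteq> x}"]) simp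
qed (fact meet_semilattice rank_function matroid_atoms)+

end

section \<open>The simple semimatroid of a geometric semilattice\<close>

locale geometric_rank = ranked_semilattice K r for K (structure) and r +
  assumes atomistic: "x \<in> carrier K \<Longrightarrow> \<exists>A\<subseteq>atoms K r. is_lub K x A"
    and matroid_atoms: "matroid (atoms K r) {A. independent_atoms K r A}"
begin

section \<open>Bounded sets of atoms and their joins\<close>

abbreviation "E \<equiv> atoms K r"

text \<open>The complex of the semimatroid under construction; its ground set is
  \<open>E\<close>.\<close>

definition bounded_atom_sets :: "'a set set" where
  "bounded_atom_sets = {A. A \<subseteq> E \<and> Upper K A \<noteq> {}}"

text \<open>The flat that will correspond to \<open>x\<close>.\<close>

definition atoms_below :: "'a \<Rightarrow> 'a set" where
  "atoms_below x = {a \<in> E. a \<sqsubseteq> x}"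

lemma atom_closed: "a \<in> E \<Longrightarrow> a \<in> carrier K"
  and rank_atom: "a \<in> E \<Longrightarrow> r a = 1"
  by (auto simp: atoms_def)

lemma finite_atoms: "finite E"
  using matroid_atoms by (rule matroid.finite_ground)

lemma bounded_subset_atoms: "A \<in> bounded_atom_sets \<Longrightarrow> A \<subseteq> E"
  by (simp add: bounded_atom_sets_def)

lemma bounded_atom_setsI:
  assumes "A \<subseteq> E" "u \<in> carrier K" "\<And>a. a \<in> A \<Longrightarrow> a \<sqsubseteq> u"
  shows "A \<in> bounded_atom_sets"
proof -
  have "u \<in> Upper K A" using assms by (auto simp: Upper_def)
  then show ?thesis using assms by (auto simp: bounded_atom_sets_def)
qed

text \<open>The meet of all upper bounds, which exists because there is at least one, is a least
  upper bound.\<close>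

lemma is_lub_Sup:
  assumes "A \<in> bounded_atom_sets"
  shows "is_lub K (\<Squnion>A) A"
proof -
  have A: "A \<subseteq> carrier K" "Upper K A \<noteq> {}"
    using assms atom_closed by (auto simp: bounded_atom_sets_def)
  obtain m where m: "is_glb K m (Upper K A)"
    using meet_exists[of "Upper K A"] A by auto
  have mc: "m \<in> carrier K" using m by auto
  have "is_lub K m A"
  proof (rule least_UpperI)
    show "a \<sqsubseteq> m" if "a \<in> A" for a
    proof (rule greatest_le[OF m])
      show "a \<in> Lower K (Upper K A)" using that A by (auto simp: Lower_def Upper_def)
    qed
    show "m \<sqsubseteq> y" if "y \<in> Upper K A" for y
      using greatest_Lower_below[OF m that] by auto
  qed (use A mc in auto)
  then show ?thesis unfolding sup_def by (rule someI)
qed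

lemma Sup_closed: "A \<in> bounded_atom_sets \<Longrightarrow> \<Squnion>A \<in> carrier K"
  using is_lub_Sup by (rule least_closed)

lemma Sup_upper: "A \<in> bounded_atom_sets \<Longrightarrow> a \<in> A \<Longrightarrow> a \<sqsubseteq> \<Squnion>A"
  using least_Upper_above[OF is_lub_Sup] bounded_subset_atoms atom_closed by blast

lemma Sup_least:
  assumes "A \<in> bounded_atom_sets" "u \<in> carrier K" "\<And>a. a \<in> A \<Longrightarrow> a \<sqsubseteq> u"
  shows "\<Squnion>A \<sqsubseteq> u"
proof (rule least_le[OF is_lub_Sup])
  show "u \<in> Upper K A" using assms by (auto simp: Upper_def)
qed (fact assms(1))

lemma bounded_subset: "B \<in> bounded_atom_sets \<Longrightarrow> A \<subseteq> B \<Longrightarrow> A \<in> bounded_atom_sets"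
  by (rule bounded_atom_setsI[of A "\<Squnion>B"])
    (use bounded_subset_atoms Sup_closed Sup_upper in auto)

lemma Sup_mono:
  assumes "A \<subseteq> B" "B \<in> bounded_atom_sets"
  shows "\<Squnion>A \<sqsubseteq> \<Squnion>B"
  using assms bounded_subset Sup_closed Sup_upper by (intro Sup_least) auto

lemma rank_Sup_mono:
  assumes "A \<subseteq> B" "B \<in> bounded_atom_sets"
  shows "r (\<Squnion>A) \<le> r (\<Squnion>B)"
  using assms bounded_subset Sup_closed Sup_mono by (intro rank_le) auto

lemma Sup_eq_if_rank_eq:
  assumes "A \<subseteq> B" "B \<in> bounded_atom_sets" "r (\<Squnion>B) = r (\<Squnion>A)"
  shows "\<Squnion>B = \<Squnion>A"
proof (rule ccontr)
  assume "\<Squnion>B \<noteq> \<Squnion>A"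
  then have "r (\<Squnion>A) < r (\<Squnion>B)"
    using assms bounded_subset Sup_closed Sup_mono by (intro rank_less) auto
  then show False using assms by simp
qed

lemma independent_iff:
  "independent_atoms K r A \<longleftrightarrow> A \<in> bounded_atom_sets \<and> r (\<Squnion>A) = card A"
  unfolding independent_atoms_def bounded_atom_sets_def
  using finite_atoms finite_subset by auto

lemma independent_subset: "independent_atoms K r A \<Longrightarrow> B \<subseteq> A \<Longrightarrow> independent_atoms K r B"
  using matroid.indep_subset[OF matroid_atoms] by blast

lemma independent_empty: "independent_atoms K r {}"
  using matroid.indep_empty[OF matroid_atoms] by blast

section \<open>Extension of independent sets\<close>

lemma le_if_atoms_below:
  assumes "x \<in> carrier K" "y \<in> carrier K" "\<And>a. a \<in> E \<Longrightarrow> a \<sqsubseteq> x \<Longrightarrow> a \<sqsubseteq> y"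
  shows "x \<sqsubseteq> y"
proof -
  obtain A where A: "A \<subseteq> E" "is_lub K x A" using atomistic assms by blast
  have "A \<subseteq> carrier K" using A atom_closed by auto
  then have "\<forall>a\<in>A. a \<sqsubseteq> y"
    using least_Upper_above[OF A(2)] A(1) assms(3) by auto
  then have "y \<in> Upper K A" using assms(2) by (auto simp: Upper_def)
  then show ?thesis by (rule least_le[OF A(2)])
qed

text \<open>Take \<open>z\<close> one rank above \<open>\<Squnion>I\<close> and below
  \<open>u\<close>, and an atom below \<open>z\<close> but not below \<open>\<Squnion>I\<close>.
  Adding it raises the rank of the join by exactly one: the join grows strictly but stays below
  \<open>z\<close>. Repeating this reaches \<open>u\<close>.\<close>

lemma extend_independent:
  assumes "independent_atoms K r I" "u \<in> carrier K" "\<Squnion>I \<sqsubseteq> u"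
  shows "\<exists>B. I \<subseteq> B \<and> independent_atoms K r B \<and> \<Squnion>B = u"
  using assms
proof (induction "r u - r (\<Squnion>I)" arbitrary: I rule: less_induct)
  case less
  have I: "I \<in> bounded_atom_sets" "r (\<Squnion>I) = card I" "\<Squnion>I \<in> carrier K" "I \<subseteq> E"
    using less.prems Sup_closed bounded_subset_atoms by (auto simp: independent_iff)
  show ?case
  proof (cases "\<Squnion>I = u")
    case True
    then show ?thesis using less.prems by blast
  next
    case False
    obtain z where z: "z \<in> carrier K" "\<Squnion>I \<sqsubseteq> z" "z \<sqsubseteq> u" "r z = r (\<Squnion>I) + 1"
      using rank_cover[OF I(3) less.prems(2,3) False] .
    have "\<not> z \<sqsubseteq> \<Squnion>I" using z rank_le[of z "\<Squnion>I"] I by auto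
    then obtain a where a: "a \<in> E" "a \<sqsubseteq> z" "\<not> a \<sqsubseteq> \<Squnion>I"
      using le_if_atoms_below z I by blast
    have below: "b \<sqsubseteq> z" if "b \<in> insert a I" for b
      using that a Sup_upper[OF I(1)] z I atom_closed le_trans[of b "\<Squnion>I" z] by auto
    have bd: "insert a I \<in> bounded_atom_sets"
      using below a z I by (intro bounded_atom_setsI) auto
    have Jz: "\<Squnion>(insert a I) \<sqsubseteq> z" using bd below z by (intro Sup_least) auto
    have "\<Squnion>(insert a I) \<noteq> \<Squnion>I" using Sup_upper[OF bd, of a] a by auto
    then have "r (\<Squnion>I) < r (\<Squnion>(insert a I))"
      using Sup_mono[OF _ bd, of I] Sup_closed[OF bd] I by (intro rank_less) auto
    then have rk: "r (\<Squnion>(insert a I)) = r (\<Squnion>I) + 1"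
      using rank_le[OF Sup_closed[OF bd] z(1) Jz] z by simp
    have "a \<notin> I" using a Sup_upper[OF I(1)] by auto
    then have ind: "independent_atoms K r (insert a I)"
      using bd rk I finite_subset[OF _ finite_atoms] by (auto simp: independent_iff)
    have Ju: "\<Squnion>(insert a I) \<sqsubseteq> u"
      using Jz z less.prems(2) Sup_closed[OF bd] le_trans by blast
    have "r u - r (\<Squnion>(insert a I)) < r u - r (\<Squnion>I)"
      using rk rank_le[OF Sup_closed[OF bd] less.prems(2) Ju] by simp
    then obtain B where "insert a I \<subseteq> B" "independent_atoms K r B" "\<Squnion>B = u"
      using less.hyps ind less.prems(2) Ju by blast
    then show ?thesis by blast
  qed
qed

text \<open>Extend \<open>I\<close> to an independent \<open>B\<close> with the same join as \<open>I \<union> {a}\<close>. Exchanging for \<open>a\<close>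
  any element of \<open>B - I\<close> changes neither the size nor the join, so the result is independent,
  and it contains \<open>I \<union> {a}\<close>.\<close>

lemma independent_insert:
  assumes I: "independent_atoms K r I" and bd: "insert a I \<in> bounded_atom_sets"
    and a: "\<not> a \<sqsubseteq> \<Squnion>I"
  shows "independent_atoms K r (insert a I)"
proof -
  define z where "z = \<Squnion>(insert a I)"
  have zc: "z \<in> carrier K" using Sup_closed[OF bd] by (simp add: z_def)
  have Ib: "I \<in> bounded_atom_sets" "r (\<Squnion>I) = card I"
    using I by (auto simp: independent_iff)
  have Iz: "\<Squnion>I \<sqsubseteq> z" using Sup_mono[OF _ bd] by (auto simp: z_def)
  have az: "a \<sqsubseteq> z" using Sup_upper[OF bd] by (simp add: z_def)
  obtain B where B: "I \<subseteq> B" "independent_atoms K r B" "\<Squnion>B = z"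
    using extend_independent[OF I zc Iz] by blast
  have Bb: "B \<in> bounded_atom_sets" "r z = card B" "finite B"
    using B bounded_subset_atoms finite_subset[OF _ finite_atoms] by (auto simp: independent_iff)
  show ?thesis
  proof (cases "a \<in> B")
    case True
    then show ?thesis using independent_subset B by simp
  next
    case False
    have "B \<noteq> I" using B(3) az a by auto
    then obtain b where b: "b \<in> B" "b \<notin> I" using B by auto
    define B' where "B' = insert a (B - {b})"
    have sub: "insert a I \<subseteq> B'" using B b by (auto simp: B'_def)
    have below: "c \<sqsubseteq> z" if "c \<in> B'" for c
      using that az Sup_upper[OF Bb(1)] B(3) by (auto simp: B'_def)
    have B'b: "B' \<in> bounded_atom_sets"
      using bounded_subset_atoms[OF Bb(1)] bounded_subset_atoms[OF bd] below zc
      by (intro bounded_atom_setsI[of _ z]) (auto simp: B'_def)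
    have "\<Squnion>B' \<sqsubseteq> z" using Sup_least[OF B'b zc below] .
    moreover have "z \<sqsubseteq> \<Squnion>B'" using Sup_mono[OF sub B'b] by (simp only: z_def)
    ultimately have "\<Squnion>B' = z" using Sup_closed[OF B'b] zc by (rule le_antisym)
    moreover have "card B' = card B"
      using False Bb(3) card_Suc_Diff1[OF Bb(3) b(1)]
      unfolding B'_def by (simp del: card_Diff_insert)
    ultimately have "independent_atoms K r B'" using B'b Bb by (simp add: independent_iff)
    then show ?thesis using independent_subset sub by blast
  qed
qed

text \<open>As long as some atom of \<open>X\<close> is not below \<open>\<Squnion>I\<close>,
  \<open>independent_insert\<close> allows it to be added. Once none is left, \<open>I\<close> and
  \<open>X\<close> have the same join, whose rank is \<open>card I\<close>.\<close>

lemma extend_to_basis: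
  assumes "X \<in> bounded_atom_sets" "independent_atoms K r I" "I \<subseteq> X"
  obtains B where "I \<subseteq> B" "B \<subseteq> X" "independent_atoms K r B" "card B = r (\<Squnion>X)"
proof -
  have finX: "finite X" using assms(1) bounded_subset_atoms finite_subset finite_atoms by blast
  have "\<exists>B. I \<subseteq> B \<and> B \<subseteq> X \<and> independent_atoms K r B \<and> card B = r (\<Squnion>X)"
    using assms(2,3)
  proof (induction "card (X - I)" arbitrary: I rule: less_induct)
    case less
    have Ib: "I \<in> bounded_atom_sets" "r (\<Squnion>I) = card I"
      using less.prems by (auto simp: independent_iff)
    show ?case
    proof (cases "\<forall>a\<in>X. a \<sqsubseteq> \<Squnion>I")
      case True
      then have "\<Squnion>X \<sqsubseteq> \<Squnion>I" using Sup_closed[OF Ib(1)] assms(1) by (intro Sup_least) auto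
      then have "\<Squnion>X = \<Squnion>I"
        using Sup_mono[OF less.prems(2) assms(1)] Sup_closed[OF assms(1)] Sup_closed[OF Ib(1)]
        by (rule le_antisym)
      then show ?thesis using less.prems Ib by auto
    next
      case False
      then obtain a where a: "a \<in> X" "\<not> a \<sqsubseteq> \<Squnion>I" by blast
      have sub: "insert a I \<subseteq> X" using a less.prems by auto
      have ind: "independent_atoms K r (insert a I)"
        using independent_insert[OF less.prems(1) bounded_subset[OF assms(1) sub] a(2)] .
      have "a \<notin> I" using a Sup_upper[OF Ib(1)] by auto
      then have "card (X - insert a I) < card (X - I)"
        using a finX by (intro psubset_card_mono) auto
      then show ?thesis using less.hyps[OF _ ind sub] by blast
    qed
  qed
  then show thesis using that by blast
qed

section \<open>The semimatroid axioms for bounded sets of atoms\<close>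

lemma card_independent_le:
  assumes "independent_atoms K r I" "I \<subseteq> X" "X \<in> bounded_atom_sets"
  shows "card I \<le> r (\<Squnion>X)"
  using rank_Sup_mono[OF assms(2,3)] assms(1) by (simp add: independent_iff)

text \<open>As for matroids: a basis \<open>I\<close> of \<open>X \<inter> Y\<close> is extended to
  a basis \<open>BX\<close> of \<open>X\<close> and then to a basis \<open>B\<close> of
  \<open>X \<union> Y\<close>. By the size of \<open>BX\<close>, the elements of
  \<open>B - BX\<close> lie outside \<open>X\<close>, so together with \<open>I\<close> they form an
  independent subset of \<open>Y\<close>.\<close>

lemma rank_Sup_submodular:
  assumes X: "X \<in> bounded_atom_sets" and Y: "Y \<in> bounded_atom_sets"
    and XY: "X \<union> Y \<in> bounded_atom_sets"
  shows "r (\<Squnion>(X \<union> Y)) + r (\<Squnion>(X \<inter> Y)) \<le> r (\<Squnion>X) + r (\<Squnion>Y)"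
proof -
  obtain I where I: "I \<subseteq> X \<inter> Y" "independent_atoms K r I" "card I = r (\<Squnion>(X \<inter> Y))"
    using extend_to_basis[OF bounded_subset[OF X] independent_empty] by (metis Int_lower1 empty_subsetI)
  obtain BX where BX: "I \<subseteq> BX" "BX \<subseteq> X" "independent_atoms K r BX" "card BX = r (\<Squnion>X)"
    using extend_to_basis[OF X I(2)] I(1) by auto
  obtain B where B: "BX \<subseteq> B" "B \<subseteq> X \<union> Y" "independent_atoms K r B" "card B = r (\<Squnion>(X \<union> Y))"
    using extend_to_basis[OF XY BX(3)] BX(2) by auto
  have fin: "finite B" by (rule finite_subset[OF _ finite_atoms]) (use B bounded_subset_atoms[OF XY] in blast)
  have "e \<notin> X" if e: "e \<in> B" "e \<notin> BX" for e
  proof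
    assume "e \<in> X"
    then have "card (insert e BX) \<le> r (\<Squnion>X)"
      using e B BX X independent_subset[OF B(3), of "insert e BX"]
      by (intro card_independent_le) auto
    then show False using BX e B fin finite_subset by fastforce
  qed
  then have sub: "I \<union> (B - BX) \<subseteq> Y" and disj: "I \<inter> (B - BX) = {}" using B I by auto
  have "card (I \<union> (B - BX)) \<le> r (\<Squnion>Y)"
    using independent_subset[OF B(3), of "I \<union> (B - BX)"] BX B sub Y
    by (intro card_independent_le) auto
  moreover have "card (I \<union> (B - BX)) = card I + card (B - BX)"
    using card_Un_disjoint[OF _ _ disj] fin finite_subset[of I B] BX(1) B(1) by auto
  moreover have "card B = card BX + card (B - BX)"
    using B fin by (metis card_Diff_subset card_mono finite_subset le_add_diff_inverse)
  ultimately show ?thesis using I BX B by simp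
qed

text \<open>Matroid augmentation of a basis \<open>BX\<close> of \<open>X\<close> from a basis of
  \<open>Y\<close> yields \<open>y\<close>. It is not in \<open>X\<close>, where
  \<open>BX \<union> {y}\<close> would be too large. As \<open>X\<close> and \<open>BX\<close> have
  the same join, \<open>\<Squnion>(BX \<union> {y})\<close> bounds
  \<open>X \<union> {y}\<close>.\<close>

lemma bounded_augment:
  assumes X: "X \<in> bounded_atom_sets" and Y: "Y \<in> bounded_atom_sets"
    and less: "r (\<Squnion>X) < r (\<Squnion>Y)"
  shows "\<exists>y\<in>Y - X. X \<union> {y} \<in> bounded_atom_sets"
proof -
  obtain BX where BX: "BX \<subseteq> X" "independent_atoms K r BX" "card BX = r (\<Squnion>X)"
    using extend_to_basis[OF X independent_empty] by auto
  obtain BY where BY: "BY \<subseteq> Y" "independent_atoms K r BY" "card BY = r (\<Squnion>Y)"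
    using extend_to_basis[OF Y independent_empty] by auto
  obtain y where y: "y \<in> BY - BX" "independent_atoms K r (BX \<union> {y})"
    using matroid.augmentation[OF matroid_atoms, of BX BY] BX BY less by auto
  have yb: "BX \<union> {y} \<in> bounded_atom_sets" using y by (simp add: independent_iff)
  have finBX: "finite BX"
    using BX bounded_subset_atoms[OF X] finite_subset[OF _ finite_atoms] by auto
  have "y \<notin> X"
  proof
    assume "y \<in> X"
    then have "card (BX \<union> {y}) \<le> r (\<Squnion>X)" using y BX X by (intro card_independent_le) auto
    then show False using y BX finBX by auto
  qed
  moreover have "X \<union> {y} \<in> bounded_atom_sets"
  proof (rule bounded_atom_setsI)
    define u where "u = \<Squnion>(BX \<union> {y})"
    show uc: "u \<in> carrier K" using Sup_closed[OF yb] by (simp add: u_def)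
    have "\<Squnion>X = \<Squnion>BX"
      using Sup_eq_if_rank_eq[OF BX(1) X] BX by (simp add: independent_iff)
    then have Xu: "\<Squnion>X \<sqsubseteq> u" using Sup_mono[OF Un_upper1 yb] by (simp only: u_def)
    show "a \<sqsubseteq> u" if a: "a \<in> X \<union> {y}" for a
    proof (cases "a \<in> X")
      case True
      then show ?thesis
        using Sup_upper[OF X] Xu uc Sup_closed[OF X] bounded_subset_atoms[OF X] atom_closed
          le_trans[of a "\<Squnion>X" u] by auto
    next
      case False
      then show ?thesis using a Sup_upper[OF yb] by (simp add: u_def)
    qed
    show "X \<union> {y} \<subseteq> E" using bounded_subset_atoms X yb by auto
  qed
  ultimately show ?thesis using y BY by auto
qed

lemma singleton_bounded: "a \<in> E \<Longrightarrow> {a} \<in> bounded_atom_sets"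
  using atom_closed by (intro bounded_atom_setsI[of _ a]) auto

lemma Sup_singleton: "a \<in> E \<Longrightarrow> \<Squnion>{a} = a"
  using singleton_bounded[of a] Sup_upper[of "{a}" a] Sup_least[of "{a}" a] Sup_closed[of "{a}"]
    atom_closed[of a] le_antisym[of "\<Squnion>{a}" a] by simp

lemma semimatroid_bounded: "semimatroid E bounded_atom_sets (\<lambda>X. r (\<Squnion>X))"
proof
  show "finite E" by (rule finite_atoms)
  show "X \<subseteq> E" if "X \<in> bounded_atom_sets" for X
    using that by (rule bounded_subset_atoms)
  show "Y \<in> bounded_atom_sets" if "X \<in> bounded_atom_sets" "Y \<subseteq> X" for X Y
    using that by (rule bounded_subset)
  show "bounded_atom_sets \<noteq> {}"
    using independent_empty by (auto simp: independent_iff)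
  show "0 \<le> r (\<Squnion>X) \<and> r (\<Squnion>X) \<le> card X" if X: "X \<in> bounded_atom_sets" for X
  proof -
    obtain B where B: "B \<subseteq> X" "card B = r (\<Squnion>X)"
      using extend_to_basis[OF X independent_empty] by auto
    moreover have "finite X"
      using bounded_subset_atoms[OF X] finite_subset[OF _ finite_atoms] by auto
    ultimately show ?thesis using card_mono[of X B] by simp
  qed
  show "r (\<Squnion>X) \<le> r (\<Squnion>Y)" if "Y \<in> bounded_atom_sets" "X \<subseteq> Y" for X Y
    using that by (simp add: rank_Sup_mono)
  show "X \<union> Y \<in> bounded_atom_sets"
    if X: "X \<in> bounded_atom_sets" and Y: "Y \<in> bounded_atom_sets"
      and eq: "r (\<Squnion>X) = r (\<Squnion>(X \<inter> Y))" for X Y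
  proof (rule bounded_atom_setsI)
    show uc: "\<Squnion>Y \<in> carrier K" using Sup_closed[OF Y] .
    \<comment> \<open>For (CR1): equal ranks of nested sets force equal joins, so
      \<open>\<Squnion>X\<close> is below \<open>\<Squnion>Y\<close>, which then bounds all of
      \<open>X \<union> Y\<close>.\<close>
    have "\<Squnion>X = \<Squnion>(X \<inter> Y)" using Sup_eq_if_rank_eq[OF _ X] eq by auto
    then have le: "\<Squnion>X \<sqsubseteq> \<Squnion>Y" using Sup_mono[OF _ Y, of "X \<inter> Y"] by simp
    show "a \<sqsubseteq> \<Squnion>Y" if a: "a \<in> X \<union> Y" for a
    proof (cases "a \<in> X")
      case True
      then show ?thesis
        using Sup_upper[OF X] le uc Sup_closed[OF X] bounded_subset_atoms[OF X] atom_closed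
          le_trans[of a "\<Squnion>X" "\<Squnion>Y"] by auto
    next
      case False
      then show ?thesis using a Sup_upper[OF Y] by simp
    qed
    show "X \<union> Y \<subseteq> E" using bounded_subset_atoms X Y by auto
  qed
qed (use rank_Sup_submodular bounded_augment in auto)

lemma simple_semimatroid_bounded: "simple_semimatroid E bounded_atom_sets (\<lambda>X. r (\<Squnion>X))"
proof -
  interpret semimatroid E bounded_atom_sets "\<lambda>X. r (\<Squnion>X)" by (rule semimatroid_bounded)
  show ?thesis
  proof
    show "{x} \<in> bounded_atom_sets" if "x \<in> E" for x using singleton_bounded that .
    show "r (\<Squnion>{x}) = 1" if "x \<in> E" for x using Sup_singleton rank_atom that by simp
    show "r (\<Squnion>{x, y}) = 2" if xy: "{x, y} \<in> bounded_atom_sets" "x \<noteq> y" for x y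
    proof (rule antisym)
      show "r (\<Squnion>{x, y}) \<le> 2" using R1[OF xy(1)] xy(2) by simp
      have xyE: "x \<in> E" "y \<in> E" using bounded_subset_atoms[OF xy(1)] by auto
      \<comment> \<open>Distinct atoms have equal rank and so are incomparable; the join of the pair
        is strictly above \<open>x\<close>.\<close>
      have "\<not> y \<sqsubseteq> x"
        using rank_less[of y x] xyE xy(2) atom_closed rank_atom by fastforce
      then have "x \<noteq> \<Squnion>{x, y}" using Sup_upper[OF xy(1), of y] by auto
      then have "r x < r (\<Squnion>{x, y})"
        using Sup_upper[OF xy(1), of x] Sup_closed[OF xy(1)] xyE atom_closed
        by (intro rank_less) auto
      then show "2 \<le> r (\<Squnion>{x, y})" using rank_atom xyE by simp
    qed
  qed
qed

section \<open>Recovery of the poset from the flats\<close>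

lemma atoms_below_bounded: "x \<in> carrier K \<Longrightarrow> atoms_below x \<in> bounded_atom_sets"
  by (rule bounded_atom_setsI) (auto simp: atoms_below_def)

lemma Sup_atoms_below:
  assumes "x \<in> carrier K"
  shows "\<Squnion>(atoms_below x) = x"
proof -
  note b = atoms_below_bounded[OF assms]
  have "\<Squnion>(atoms_below x) \<sqsubseteq> x" using b assms by (intro Sup_least) (auto simp: atoms_below_def)
  moreover have "x \<sqsubseteq> \<Squnion>(atoms_below x)"
    using Sup_upper[OF b]
    by (intro le_if_atoms_below[OF assms Sup_closed[OF b]]) (simp add: atoms_below_def)
  ultimately show ?thesis using Sup_closed[OF b] assms by (rule le_antisym)
qed

text \<open>The isomorphism is \<open>atoms_below\<close>, with inverse \<open>\<Squnion>\<close>.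
  The key identity is \<open>cl A = atoms_below (\<Squnion>A)\<close>: an atom that keeps the rank
  keeps the join, and conversely \<open>atoms_below (\<Squnion>A)\<close> has the same join as
  \<open>A\<close>, hence the same rank.\<close>

lemma poset_iso_bounded:
  "poset_iso K (flat_poset E bounded_atom_sets (\<lambda>X. r (\<Squnion>X)))"
proof -
  interpret semimatroid E bounded_atom_sets "\<lambda>X. r (\<Squnion>X)" by (rule semimatroid_bounded)
  have le: "x \<sqsubseteq> y \<longleftrightarrow> atoms_below x \<subseteq> atoms_below y"
    if xy: "x \<in> carrier K" "y \<in> carrier K" for x y
  proof
    show "atoms_below x \<subseteq> atoms_below y" if "x \<sqsubseteq> y"
      using that xy atom_closed le_trans[of _ x y] by (auto simp: atoms_below_def)
    show "x \<sqsubseteq> y" if "atoms_below x \<subseteq> atoms_below y"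
      using subsetD[OF that] by (intro le_if_atoms_below[OF xy]) (simp add: atoms_below_def)
  qed
  have below_Sup: "cl A = atoms_below (\<Squnion>A)" if A: "A \<in> bounded_atom_sets" for A
  proof
    show "cl A \<subseteq> atoms_below (\<Squnion>A)"
    proof
      fix a assume a: "a \<in> cl A"
      then have c: "a \<in> E" "A \<union> {a} \<in> bounded_atom_sets" "r (\<Squnion>(A \<union> {a})) = r (\<Squnion>A)"
        by (auto simp: semimatroid_closure_def)
      then have "\<Squnion>(A \<union> {a}) = \<Squnion>A" by (intro Sup_eq_if_rank_eq) auto
      then show "a \<in> atoms_below (\<Squnion>A)"
        using Sup_upper[OF c(2), of a] c(1) by (simp add: atoms_below_def)
    qed
    show "atoms_below (\<Squnion>A) \<subseteq> cl A"
    proof (rule closure_maximal)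
      show "A \<subseteq> atoms_below (\<Squnion>A)"
        using Sup_upper[OF A] bounded_subset_atoms[OF A] by (auto simp: atoms_below_def)
    qed (simp_all add: Sup_closed[OF A] atoms_below_bounded Sup_atoms_below)
  qed
  have "bij_betw atoms_below (carrier K) (flats E bounded_atom_sets (\<lambda>X. r (\<Squnion>X)))"
  proof (rule bij_betw_imageI)
    show "inj_on atoms_below (carrier K)" using Sup_atoms_below by (metis inj_onI)
    show "atoms_below ` carrier K = flats E bounded_atom_sets (\<lambda>X. r (\<Squnion>X))"
    proof
      show "atoms_below ` carrier K \<subseteq> flats E bounded_atom_sets (\<lambda>X. r (\<Squnion>X))"
        using below_Sup atoms_below_bounded Sup_atoms_below by (auto simp: flats_def)
      show "flats E bounded_atom_sets (\<lambda>X. r (\<Squnion>X)) \<subseteq> atoms_below ` carrier K"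
      proof
        fix A assume "A \<in> flats E bounded_atom_sets (\<lambda>X. r (\<Squnion>X))"
        then have "A \<in> bounded_atom_sets" "cl A = A" by (auto simp: flats_def)
        then show "A \<in> atoms_below ` carrier K" using below_Sup Sup_closed by (metis imageI)
      qed
    qed
  qed
  then show ?thesis
    unfolding poset_iso_def flat_poset_def using le by auto
qed

end

lemma geometric_semilattice_iff_rank: "geometric_semilattice K \<longleftrightarrow> (\<exists>r. geometric_rank K r)"
  unfolding geometric_semilattice_def geometric_rank_def geometric_rank_axioms_def
    ranked_semilattice_def ranked_semilattice_axioms_def by blast

lemma poset_iso_flat_posetE:
  assumes "partial_order K" "semimatroid S C r" "poset_iso K (flat_poset S C r)"
  obtains F where "flat_representation K S C r F"
proof -
  obtain F where F: "bij_betw F (carrier K) (flats S C r)"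
      "\<And>x y. x \<in> carrier K \<Longrightarrow> y \<in> carrier K \<Longrightarrow> x \<sqsubseteq>\<^bsub>K\<^esub> y \<longleftrightarrow> F x \<subseteq> F y"
    using assms(3) unfolding poset_iso_def flat_poset_def by auto
  show thesis
    by (rule that[of F])
      (use assms F in \<open>simp add: flat_representation_def flat_representation_axioms_def\<close>)
qed

lemma geometric_semilattice_if_flat_poset:
  assumes "partial_order K" "semimatroid S C r" "poset_iso K (flat_poset S C r)"
  shows "geometric_semilattice K"
  using poset_iso_flat_posetE[OF assms] flat_representation.geometric_semilattice by metis

section \<open>Relabelling the ground set\<close>

text \<open>Allows the ground set to be replaced by a set of natural numbers. Injectivity of
  \<open>e\<close> makes images preserve cardinalities and intersections, so each axiom is inherited
  from the image sets.\<close>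

lemma (in semimatroid) semimatroid_pullback:
  assumes e: "bij_betw e T S"
  shows "semimatroid T {X. X \<subseteq> T \<and> e ` X \<in> C} (\<lambda>X. r (e ` X))"
proof
  have inj: "inj_on e T" using e by (rule bij_betw_imp_inj_on)
  have Int: "e ` (X \<inter> Y) = e ` X \<inter> e ` Y" if "X \<subseteq> T" "Y \<subseteq> T" for X Y
    using inj that by (rule inj_on_image_Int)
  show "finite T" using e finite_ground by (simp add: bij_betw_finite)
  show "X \<subseteq> T" if "X \<in> {X. X \<subseteq> T \<and> e ` X \<in> C}" for X
    using that by simp
  show "Y \<in> {X. X \<subseteq> T \<and> e ` X \<in> C}" if "X \<in> {X. X \<subseteq> T \<and> e ` X \<in> C}" "Y \<subseteq> X" for X Y
    using that down_closed[of "e ` X" "e ` Y"] by auto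
  show "{X. X \<subseteq> T \<and> e ` X \<in> C} \<noteq> {}"
    using empty_in_complex by auto
  show "0 \<le> r (e ` X) \<and> r (e ` X) \<le> card X" if "X \<in> {X. X \<subseteq> T \<and> e ` X \<in> C}" for X
    using that R1[of "e ` X"] inj_on_subset[OF inj] by (simp add: card_image)
  show "r (e ` X) \<le> r (e ` Y)"
    if "X \<in> {X. X \<subseteq> T \<and> e ` X \<in> C}" "Y \<in> {X. X \<subseteq> T \<and> e ` X \<in> C}" "X \<subseteq> Y" for X Y
    using that R2[of "e ` X" "e ` Y"] by auto
  show "r (e ` X) + r (e ` Y) \<ge> r (e ` (X \<union> Y)) + r (e ` (X \<inter> Y))"
    if "X \<in> {X. X \<subseteq> T \<and> e ` X \<in> C}" "Y \<in> {X. X \<subseteq> T \<and> e ` X \<in> C}"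
      "X \<union> Y \<in> {X. X \<subseteq> T \<and> e ` X \<in> C}" for X Y
    using that R3[of "e ` X" "e ` Y"] Int[of X Y] by (simp add: image_Un)
  show "X \<union> Y \<in> {X. X \<subseteq> T \<and> e ` X \<in> C}"
    if "X \<in> {X. X \<subseteq> T \<and> e ` X \<in> C}" "Y \<in> {X. X \<subseteq> T \<and> e ` X \<in> C}"
      "r (e ` X) = r (e ` (X \<inter> Y))" for X Y
    using that CR1[of "e ` X" "e ` Y"] Int[of X Y] by (simp add: image_Un)
  show "\<exists>y\<in>Y - X. X \<union> {y} \<in> {X. X \<subseteq> T \<and> e ` X \<in> C}"
    if X: "X \<in> {X. X \<subseteq> T \<and> e ` X \<in> C}" and Y: "Y \<in> {X. X \<subseteq> T \<and> e ` X \<in> C}"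
      and less: "r (e ` X) < r (e ` Y)" for X Y
  proof -
    obtain z where z: "z \<in> e ` Y - e ` X" "e ` X \<union> {z} \<in> C"
      using CR2[of "e ` X" "e ` Y"] X Y less by auto
    then obtain y where y: "y \<in> Y" "z = e y" by auto
    then have "y \<in> Y - X" "X \<union> {y} \<in> {X. X \<subseteq> T \<and> e ` X \<in> C}" using z X Y by auto
    then show ?thesis by blast
  qed
qed

lemma (in simple_semimatroid) simple_semimatroid_pullback:
  assumes e: "bij_betw e T S"
  shows "simple_semimatroid T {X. X \<subseteq> T \<and> e ` X \<in> C} (\<lambda>X. r (e ` X))"
proof -
  interpret T: semimatroid T "{X. X \<subseteq> T \<and> e ` X \<in> C}" "\<lambda>X. r (e ` X)"
    using e by (rule semimatroid_pullback)
  have eS: "e x \<in> S" if "x \<in> T" for x using e that by (auto simp: bij_betw_def)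
  show ?thesis
  proof
    show "{x} \<in> {X. X \<subseteq> T \<and> e ` X \<in> C}" if "x \<in> T" for x
      using that singleton_in_complex eS by simp
    show "r (e ` {x}) = 1" if "x \<in> T" for x
      using that rank_singleton eS by simp
    show "r (e ` {x, y}) = 2" if "{x, y} \<in> {X. X \<subseteq> T \<and> e ` X \<in> C}" "x \<noteq> y" for x y
    proof -
      have "e x \<noteq> e y" using that bij_betw_imp_inj_on[OF e] by (auto simp: inj_on_def)
      then show ?thesis using that rank_pair[of "e x" "e y"] by simp
    qed
  qed
qed

text \<open>Images under \<open>e\<close> turn closures on \<open>T\<close> into closures on
  \<open>S\<close>, so flats correspond to flats, and the preimages under \<open>e\<close> of the
  flats \<open>f x\<close> give the new isomorphism.\<close>

lemma (in semimatroid) poset_iso_pullback: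
  assumes e: "bij_betw e T S" and iso: "poset_iso K (flat_poset S C r)"
  shows "poset_iso K (flat_poset T {X. X \<subseteq> T \<and> e ` X \<in> C} (\<lambda>X. r (e ` X)))"
proof -
  let ?C = "{X. X \<subseteq> T \<and> e ` X \<in> C}" and ?r = "\<lambda>X. r (e ` X)"
  have inj: "inj_on e T" and im: "e ` T = S" using e by (auto simp: bij_betw_def)
  have img: "e ` {i \<in> T. e i \<in> A} = A" if "A \<subseteq> S" for A
    using that im by auto
  have flats: "A \<in> flats T ?C ?r \<longleftrightarrow> e ` A \<in> flats S C r" if A: "A \<subseteq> T" for A
  proof -
    have "semimatroid_closure T ?C ?r A = {i \<in> T. e i \<in> cl (e ` A)}"
      using A im by (auto simp: semimatroid_closure_def)
    then have "e ` semimatroid_closure T ?C ?r A = cl (e ` A)"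
      using img[of "cl (e ` A)"] by (simp add: semimatroid_closure_def)
    moreover have "semimatroid_closure T ?C ?r A \<subseteq> T" by (auto simp: semimatroid_closure_def)
    ultimately have "semimatroid_closure T ?C ?r A = A \<longleftrightarrow> cl (e ` A) = e ` A"
      using inj_on_image_eq_iff[OF inj, of "semimatroid_closure T ?C ?r A" A] A by simp
    then show ?thesis using A by (simp add: flats_def)
  qed
  obtain f where f: "bij_betw f (carrier K) (flats S C r)"
    and le: "\<And>x y. x \<in> carrier K \<Longrightarrow> y \<in> carrier K \<Longrightarrow> x \<sqsubseteq>\<^bsub>K\<^esub> y \<longleftrightarrow> f x \<subseteq> f y"
    using iso by (auto simp: poset_iso_def flat_poset_def)
  define g where "g x = {i \<in> T. e i \<in> f x}" for x
  have ff: "f x \<in> flats S C r" if "x \<in> carrier K" for x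
    using f that by (auto simp: bij_betw_def)
  have eg: "e ` g x = f x" if "x \<in> carrier K" for x
    using img[of "f x"] ff[OF that] flat_in_complex subset_ground by (simp add: g_def)
  have gT: "g x \<subseteq> T" for x by (auto simp: g_def)
  have "bij_betw g (carrier K) (flats T ?C ?r)"
  proof (rule bij_betw_imageI)
    show "inj_on g (carrier K)"
    proof (rule inj_onI)
      fix x y assume xy: "x \<in> carrier K" "y \<in> carrier K" "g x = g y"
      then have "f x = f y" using eg[OF xy(1)] eg[OF xy(2)] by simp
      then show "x = y" using bij_betw_imp_inj_on[OF f] xy by (auto dest: inj_onD)
    qed
    show "g ` carrier K = flats T ?C ?r"
    proof
      show "g ` carrier K \<subseteq> flats T ?C ?r" using flats[OF gT] eg ff by auto
      show "flats T ?C ?r \<subseteq> g ` carrier K"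
      proof
        fix A assume A: "A \<in> flats T ?C ?r"
        then have AT: "A \<subseteq> T" by (auto simp: flats_def)
        then have "e ` A \<in> f ` carrier K" using flats A f by (simp add: bij_betw_def)
        then obtain x where x: "x \<in> carrier K" "f x = e ` A" by auto
        then have "g x = A" using eg[OF x(1)] inj_on_image_eq_iff[OF inj gT AT] by simp
        then show "A \<in> g ` carrier K" using x by auto
      qed
    qed
  qed
  moreover have "x \<sqsubseteq>\<^bsub>K\<^esub> y \<longleftrightarrow> g x \<subseteq> g y" if "x \<in> carrier K" "y \<in> carrier K" for x y
  proof -
    have "g x \<subseteq> g y" if "f x \<subseteq> f y" using that by (auto simp: g_def)
    moreover have "f x \<subseteq> f y" if "g x \<subseteq> g y"
      using image_mono[OF that, of e] eg \<open>x \<in> carrier K\<close> \<open>y \<in> carrier K\<close> by simp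
    ultimately show ?thesis using le[OF that] by blast
  qed
  ultimately show ?thesis by (auto simp: poset_iso_def flat_poset_def)
qed

section \<open>Uniqueness of the simple semimatroid\<close>

locale simple_flat_representation = flat_representation K S C r F + simple_semimatroid S C r
  for K (structure) and S :: "'a set" and C and r and F :: "'k \<Rightarrow> 'a set"
begin

text \<open>Meant for atoms, whose flats are singletons by \<open>F_atom\<close>.\<close>

definition point :: "'k \<Rightarrow> 'a" where "point a = the_elem (F a)"

text \<open>A second element \<open>t\<close> in the closure would give the pair
  \<open>{s, t}\<close> rank one, against simplicity.\<close>

lemma closure_singleton:
  assumes "s \<in> S"
  shows "cl {s} = {s}"
proof
  have c: "{s} \<in> C" "r {s} = 1" using assms singleton_in_complex rank_singleton by auto
  show "{s} \<subseteq> cl {s}" using closure_extensive c by blast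
  show "cl {s} \<subseteq> {s}"
  proof
    fix t assume "t \<in> cl {s}"
    then have "{s, t} \<in> C" "r {s, t} = 1"
      using c by (auto simp: semimatroid_closure_def insert_commute)
    then show "t \<in> {s}" using rank_pair[of s t] by auto
  qed
qed

text \<open>A flat of rank one contains some \<open>s\<close>, since \<open>{}\<close> has rank
  zero, and lies in \<open>cl {s}\<close>, since \<open>{s}\<close> already has rank one.\<close>

lemma F_atom:
  assumes "a \<in> atoms K rk"
  shows "F a = {point a}"
proof -
  have a: "a \<in> carrier K" "rk a = 1" using assms by (auto simp: atoms_iff)
  then have "F a \<noteq> {}" using rank_empty by auto
  then obtain s where s: "s \<in> F a" by auto
  then have sS: "s \<in> S" using F_in_complex[OF a(1)] subset_ground by auto
  have "F a \<subseteq> cl {s}"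
    using closure_maximal[of "{s}" "F a"] s a F_in_complex rank_singleton sS by simp
  then have "F a = {s}" using s closure_singleton sS by auto
  then show ?thesis by (simp add: point_def)
qed

lemma bij_betw_point: "bij_betw point (atoms K rk) S"
proof (rule bij_betw_imageI)
  show "inj_on point (atoms K rk)"
    using F_atom F_inj by (intro inj_onI) (metis atoms_iff)
  show "point ` atoms K rk = S"
  proof
    show "point ` atoms K rk \<subseteq> S"
    proof
      fix s assume "s \<in> point ` atoms K rk"
      then obtain a where "a \<in> atoms K rk" "F a = {s}" using F_atom by auto
      then show "s \<in> S" using F_in_complex[of a] subset_ground by (auto simp: atoms_iff)
    qed
    show "S \<subseteq> point ` atoms K rk"
    proof
      fix s assume s: "s \<in> S"
      then have "{s} \<in> flats S C r"
        using singleton_in_complex closure_singleton by (simp add: flats_def)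
      then obtain a where "a \<in> carrier K" "F a = {s}" by (rule F_surj)
      then have "a \<in> atoms K rk" "point a = s"
        using rank_singleton s by (auto simp: atoms_iff point_def)
      then show "s \<in> point ` atoms K rk" by blast
    qed
  qed
qed

text \<open>Expresses the complex and the rank of the semimatroid through bounds, joins and the rank
  function of \<open>K\<close>.\<close>

lemma point_image_in_complex_iff:
  assumes "A \<subseteq> atoms K rk"
  shows "point ` A \<in> C \<longleftrightarrow> Upper K A \<noteq> {}"
    and "Upper K A \<noteq> {} \<Longrightarrow> \<Squnion>A \<in> carrier K \<and> r (point ` A) = rk (\<Squnion>A)"
proof -
  have AK: "A \<subseteq> carrier K" using assms by (auto simp: atoms_iff)
  have eq: "\<Union>(F ` A) = point ` A" using assms F_atom by auto
  show iff: "point ` A \<in> C \<longleftrightarrow> Upper K A \<noteq> {}" using bounded_iff[OF AK] eq by simp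
  show "\<Squnion>A \<in> carrier K \<and> r (point ` A) = rk (\<Squnion>A)" if "Upper K A \<noteq> {}"
    using rank_Sup[OF AK] Sup_closed[OF AK] iff that eq by simp
qed

end

text \<open>The rank function of \<open>K\<close> is unique, so both representations have the same
  atoms. The map \<open>f\<close> sends the point of an atom in the first semimatroid to its point
  in the second; membership and rank are read off \<open>K\<close> on both sides.\<close>

lemma simple_semimatroid_unique:
  assumes "simple_flat_representation K S1 C1 r1 F1" "simple_flat_representation K S2 C2 r2 F2"
  shows "semimatroid_iso S1 C1 r1 S2 C2 r2"
proof -
  interpret A: simple_flat_representation K S1 C1 r1 F1 by fact
  interpret B: simple_flat_representation K S2 C2 r2 F2 by fact
  have rk: "r1 (F1 x) = r2 (F2 x)" if "x \<in> carrier K" for x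
    using rank_function_unique[OF A.rank_function B.rank_function that] .
  define E where "E = atoms K A.rk"
  have E2: "E = atoms K B.rk" unfolding E_def atoms_def using rk by auto
  define f where "f = B.point \<circ> inv_into E A.point"
  have b1: "bij_betw A.point E S1" using A.bij_betw_point by (simp add: E_def)
  have b2: "bij_betw B.point E S2" using B.bij_betw_point by (simp add: E2)
  have f: "bij_betw f S1 S2"
    unfolding f_def using bij_betw_inv_into[OF b1] b2 by (rule bij_betw_trans)
  have fpoint: "f ` (A.point ` X) = B.point ` X" if "X \<subseteq> E" for X
    unfolding f_def image_comp[symmetric]
    using that bij_betw_imp_inj_on[OF b1] by (simp add: inv_into_image_cancel)
  have pre: "\<exists>X\<subseteq>E. Y = A.point ` X" if "Y \<subseteq> S1" for Y
    using that b1 subset_image_iff[of Y A.point E] by (simp add: bij_betw_def)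
  have pre2: "\<exists>X\<subseteq>E. Y = B.point ` X" if "Y \<subseteq> S2" for Y
    using that b2 subset_image_iff[of Y B.point E] by (simp add: bij_betw_def)
  have complex: "A.point ` X \<in> C1 \<longleftrightarrow> B.point ` X \<in> C2" if "X \<subseteq> E" for X
    using A.point_image_in_complex_iff(1)[of X] B.point_image_in_complex_iff(1)[of X] that
    by (simp add: E_def[symmetric] E2[symmetric])
  have rank: "r1 c = r2 (f ` c)" if c: "c \<in> C1" for c
  proof -
    obtain X where X: "X \<subseteq> E" "c = A.point ` X" using pre A.subset_ground c by blast
    have "Upper K X \<noteq> {}"
      using A.point_image_in_complex_iff(1)[of X] X c by (simp add: E_def)
    then show ?thesis
      using A.point_image_in_complex_iff(2)[of X] B.point_image_in_complex_iff(2)[of X] X rk fpoint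
      by (simp add: E_def[symmetric] E2[symmetric])
  qed
  have "bij_betw (image f) C1 C2"
  proof (rule bij_betw_imageI)
    have "C1 \<subseteq> Pow S1" using A.subset_ground by auto
    then show "inj_on (image f) C1"
      using inj_on_image_Pow[OF bij_betw_imp_inj_on[OF f]] inj_on_subset by blast
    show "image f ` C1 = C2"
    proof
      show "image f ` C1 \<subseteq> C2"
      proof
        fix c assume "c \<in> image f ` C1"
        then obtain d where d: "d \<in> C1" "c = f ` d" by auto
        obtain X where "X \<subseteq> E" "d = A.point ` X" using pre A.subset_ground d(1) by blast
        then show "c \<in> C2" using d complex fpoint by simp
      qed
      show "C2 \<subseteq> image f ` C1"
      proof
        fix c assume c: "c \<in> C2"
        obtain X where X: "X \<subseteq> E" "c = B.point ` X" using pre2 B.subset_ground c by blast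
        then have "c = f ` (A.point ` X)" "A.point ` X \<in> C1" using c complex fpoint by auto
        then show "c \<in> image f ` C1" by (rule image_eqI)
      qed
    qed
  qed
  then show ?thesis unfolding semimatroid_iso_def using f rank by blast
qed

section \<open>Existence over the natural numbers and the combined statement\<close>

lemma geometric_semilattice_nat_representation:
  assumes "geometric_semilattice K"
  shows "\<exists>(S :: nat set) C r. simple_semimatroid S C r \<and> poset_iso K (flat_poset S C r)"
proof -
  obtain r where "geometric_rank K r"
    using assms geometric_semilattice_iff_rank by blast
  then interpret geometric_rank K r .
  interpret M: simple_semimatroid E bounded_atom_sets "\<lambda>X. r (\<Squnion>\<^bsub>K\<^esub>X)"
    by (rule simple_semimatroid_bounded)
  \<comment> \<open>The finitely many atoms are numbered, and the semimatroid on them is pulled back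
    along the numbering.\<close>
  obtain e :: "nat \<Rightarrow> _" where e: "bij_betw e {0..<card E} E"
    using ex_bij_betw_nat_finite[OF finite_atoms] by blast
  show ?thesis
    using M.simple_semimatroid_pullback[OF e] M.poset_iso_pullback[OF e poset_iso_bounded] by blast
qed

text \<open>An existential statement has to fix the type of the ground set; \<open>nat\<close> has
  room for every finite set. Statements about given semimatroids range over arbitrary types
  \<open>'a\<close> and \<open>'b\<close>.\<close>

theorem theorem6p4:
  fixes K :: "('k, 'm) gorder_scheme"
  assumes "partial_order K"
  shows
    "(geometric_semilattice K \<longleftrightarrow>
        (\<exists>(S :: nat set) C r. semimatroid S C r \<and> poset_iso K (flat_poset S C r))) \<and>
     (\<forall>(S :: 'a set) C r. semimatroid S C r \<and> poset_iso K (flat_poset S C r) \<longrightarrow>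
        geometric_semilattice K) \<and>
     (geometric_semilattice K \<longrightarrow>
        (\<exists>(S :: nat set) C r. simple_semimatroid S C r \<and> poset_iso K (flat_poset S C r)) \<and>
        (\<forall>(S1 :: 'a set) C1 r1 (S2 :: 'b set) C2 r2.
           simple_semimatroid S1 C1 r1 \<and> poset_iso K (flat_poset S1 C1 r1) \<and>
           simple_semimatroid S2 C2 r2 \<and> poset_iso K (flat_poset S2 C2 r2) \<longrightarrow>
           semimatroid_iso S1 C1 r1 S2 C2 r2))"
proof -
  have unique: "semimatroid_iso S1 C1 r1 S2 C2 r2"
    if *: "simple_semimatroid S1 C1 r1" "poset_iso K (flat_poset S1 C1 r1)"
      "simple_semimatroid S2 C2 r2" "poset_iso K (flat_poset S2 C2 r2)"
    for S1 :: "'a set" and C1 r1 and S2 :: "'b set" and C2 r2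
  proof -
    have s: "semimatroid S1 C1 r1" "semimatroid S2 C2 r2"
      using * by (auto intro: simple_semimatroid.axioms)
    obtain F1 where F1: "flat_representation K S1 C1 r1 F1"
      using poset_iso_flat_posetE[OF assms s(1) *(2)] .
    obtain F2 where F2: "flat_representation K S2 C2 r2 F2"
      using poset_iso_flat_posetE[OF assms s(2) *(4)] .
    show ?thesis
      using F1 F2 * by (intro simple_semimatroid_unique simple_flat_representation.intro)
  qed
  show ?thesis
  proof (intro conjI impI allI)
    show "geometric_semilattice K \<longleftrightarrow>
      (\<exists>(S :: nat set) C r. semimatroid S C r \<and> poset_iso K (flat_poset S C r))"
      using geometric_semilattice_nat_representation simple_semimatroid.axioms(1)
        geometric_semilattice_if_flat_poset[OF assms] by metis
  qed (use geometric_semilattice_nat_representation geometric_semilattice_if_flat_poset[OF assms]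
      unique in blast)+
qed

end
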